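(* Let $\lambda>0$, $p\in(0,1)$ and $\mu_1,\mu_2,\theta>0$ with $\frac{p}{\mu_1}+\frac{1-p}{\mu_2}=1$. For all $n\ge 1$, all $\theta,\mu_1,\mu_2$ satisfying $0<\theta<\min(\mu_1,\mu_2)$, and all non-negative integer triplets $(n_1,n_2,w)$ with $n_1+n_2=n$ and $w=0$, one may construct the CTMCs $Q=(N_1,N_2,W)$ and $\overline{Q}=(\overline N_1,\overline N_2,\overline W)$ defined in the context on a common probability space such that $Q(0)=\overline Q(0)=(n_1,n_2,w)$ and, with probability $1$, $\overline W(t)\ge W(t)$ for all $t\ge 0$.
   Context: $I(\cdot)$ denotes an indicator. Both processes are continuous-time Markov chains (CTMCs) with state a triplet of non-negative integers (number of type-1 jobs in service, number of type-2 jobs in service, number waiting in queue); $q(x,y)$ is the rate of transition from state $x$ to state $y$; unlisted off-diagonal rates are $0$. $Q$ (the $M/H_2/n+M$ queue with arrival rate $\lambda$, hyper-exponential services with parameters $\mu_1,\mu_2,p$, and exponential patience of rate $\theta$) has rates out of $(N_1,N_2,W)$: to $(N_1+1,N_2,W)$: $I(N_1+N_2\le n-1)\lambda p$; to $(N_1,N_2+1,W)$: $I(N_1+N_2\le n-1)\lambda(1-p)$; to $(N_1,N_2,W+1)$: $I(N_1+N_2=n)\lambda$; to $(N_1-1,N_2,W)$: $I(W=0)\mu_1N_1$; to $(N_1,N_2-1,W)$: $I(W=0)\mu_2N_2$; to $(N_1-1,N_2+1,W-1)$: $I(W\ge1)\mu_1N_1(1-p)$; to $(N_1+1,N_2-1,W-1)$: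 $I(W\ge1)\mu_2N_2p$; to $(N_1,N_2,W-1)$: $I(W\ge1)(\mu_1N_1p+\mu_2N_2(1-p)+\theta W)$. $\overline Q$ (informally, the same system with an extra arrival added any time a server would otherwise go idle) has rates out of $(\overline N_1,\overline N_2,\overline W)$: to $(\overline N_1,\overline N_2,\overline W+1)$: $\lambda$; to $(\overline N_1-1,\overline N_2+1,\overline W)$: $I(\overline W=0)\mu_1\overline N_1(1-p)$; to $(\overline N_1+1,\overline N_2-1,\overline W)$: $I(\overline W=0)\mu_2\overline N_2p$; to $(\overline N_1-1,\overline N_2+1,\overline W-1)$: $I(\overline W\ge1)\mu_1\overline N_1(1-p)$; to $(\overline N_1+1,\overline N_2-1,\overline W-1)$: $I(\overline W\ge1)\mu_2\overline N_2p$; to $(\overline N_1,\overline N_2,\overline W-1)$: $I(\overline W\ge1)(\mu_1\overline N_1p+\mu_2\overline N_2(1-p)+\theta\overline W)$. *)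

theory Defs
  imports "HOL-Probability.Probability"
begin

text \<open>
  Continuous-time Markov chains on a countable state space, presented by their off-diagonal
  transition rates \<open>q x y\<close>. The values \<open>q x x\<close> are never used.
\<close>

definition generator :: "('s \<Rightarrow> 's \<Rightarrow> real) \<Rightarrow> 's \<Rightarrow> 's \<Rightarrow> real" where
  "generator q x y = (if x = y then - infsum (q x) (- {x}) else q x y)"

text \<open>Chapman--Kolmogorov semigroups of stochastic kernels; only times \<open>t \<ge> 0\<close> matter.\<close>

definition transition_function :: "(real \<Rightarrow> 's \<Rightarrow> 's pmf) \<Rightarrow> bool" where
  "transition_function P \<longleftrightarrow>
     P 0 = return_pmf \<and>
     (\<forall>s\<ge>0. \<forall>t\<ge>0. \<forall>x. P (s + t) x = bind_pmf (P s x) (P t))"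

definition has_rates :: "(real \<Rightarrow> 's \<Rightarrow> 's pmf) \<Rightarrow> ('s \<Rightarrow> 's \<Rightarrow> real) \<Rightarrow> bool" where
  "has_rates P q \<longleftrightarrow>
     (\<forall>x y. ((\<lambda>t. pmf (P t x) y) has_real_derivative generator q x y) (at_right 0))"

definition markov_with ::
    "'w measure \<Rightarrow> (real \<Rightarrow> 'w \<Rightarrow> 's) \<Rightarrow> (real \<Rightarrow> 's \<Rightarrow> 's pmf) \<Rightarrow> bool" where
  "markov_with M X P \<longleftrightarrow>
     (\<forall>k (t :: nat \<Rightarrow> real) (x :: nat \<Rightarrow> 's).
        0 \<le> t 0 \<longrightarrow> (\<forall>i\<le>k. t i < t (Suc i)) \<longrightarrow>
        measure M {\<omega> \<in> space M. \<forall>i\<le>Suc k. X (t i) \<omega> = x i} =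
        measure M {\<omega> \<in> space M. \<forall>i\<le>k. X (t i) \<omega> = x i} *
          pmf (P (t (Suc k) - t k) (x k)) (x (Suc k)))"

text \<open>
  The process \<open>X\<close> (indexed by \<open>t \<ge> 0\<close>) has right-continuous paths for the discrete topology on
  states, and is Markov with some transition function whose derivative at \<open>0\<close> is the generator
  of \<open>q\<close>. When the rates are non-explosive, as for both chains below, the generator determines
  this transition function, hence the law of \<open>X\<close> given its initial state.
\<close>

definition is_ctmc ::
    "'w measure \<Rightarrow> (real \<Rightarrow> 'w \<Rightarrow> 's) \<Rightarrow> ('s \<Rightarrow> 's \<Rightarrow> real) \<Rightarrow> bool" where
  "is_ctmc M X q \<longleftrightarrow>
     prob_space M \<and>
     (\<forall>t\<ge>0. X t \<in> measurable M (count_space UNIV)) \<and>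
     (\<forall>\<omega>\<in>space M. \<forall>t\<ge>0. \<forall>\<^sub>F s in at_right t. X s \<omega> = X t \<omega>) \<and>
     (\<exists>P. transition_function P \<and> has_rates P q \<and> markov_with M X P)"

text \<open>States: (type-1 jobs in service, type-2 jobs in service, jobs waiting).\<close>

type_synonym state = "nat \<times> nat \<times> nat"

definition waiting :: "state \<Rightarrow> nat" where
  "waiting s = snd (snd s)"

text \<open>
  Decrements of a coordinate are written as increments of the target coordinate, so that natural
  number subtraction never truncates. In each chain the listed targets are pairwise distinct and
  differ from the source.
\<close>

fun Q_rate :: "real \<Rightarrow> real \<Rightarrow> real \<Rightarrow> real \<Rightarrow> real \<Rightarrow> nat \<Rightarrow> state \<Rightarrow> state \<Rightarrow> real" where
  "Q_rate lam p mu1 mu2 theta n (a, b, w) (a', b', w') =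
     (if a' = a + 1 \<and> b' = b \<and> w' = w then of_bool (a + b < n) * (lam * p)
      else if a' = a \<and> b' = b + 1 \<and> w' = w then of_bool (a + b < n) * (lam * (1 - p))
      else if a' = a \<and> b' = b \<and> w' = w + 1 then of_bool (a + b = n) * lam
      else if a' + 1 = a \<and> b' = b \<and> w' = w then of_bool (w = 0) * (mu1 * real a)
      else if a' = a \<and> b' + 1 = b \<and> w' = w then of_bool (w = 0) * (mu2 * real b)
      else if a' + 1 = a \<and> b' = b + 1 \<and> w' + 1 = w then
        of_bool (w \<ge> 1) * (mu1 * real a * (1 - p))
      else if a' = a + 1 \<and> b' + 1 = b \<and> w' + 1 = w then
        of_bool (w \<ge> 1) * (mu2 * real b * p)
      else if a' = a \<and> b' = b \<and> w' + 1 = w then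
        of_bool (w \<ge> 1) * (mu1 * real a * p + mu2 * real b * (1 - p) + theta * real w)
      else 0)"

fun Qbar_rate :: "real \<Rightarrow> real \<Rightarrow> real \<Rightarrow> real \<Rightarrow> real \<Rightarrow> state \<Rightarrow> state \<Rightarrow> real" where
  "Qbar_rate lam p mu1 mu2 theta (a, b, w) (a', b', w') =
     (if a' = a \<and> b' = b \<and> w' = w + 1 then lam
      else if a' + 1 = a \<and> b' = b + 1 \<and> w' = w then of_bool (w = 0) * (mu1 * real a * (1 - p))
      else if a' = a + 1 \<and> b' + 1 = b \<and> w' = w then of_bool (w = 0) * (mu2 * real b * p)
      else if a' + 1 = a \<and> b' = b + 1 \<and> w' + 1 = w then
        of_bool (w \<ge> 1) * (mu1 * real a * (1 - p))
      else if a' = a + 1 \<and> b' + 1 = b \<and> w' + 1 = w then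
        of_bool (w \<ge> 1) * (mu2 * real b * p)
      else if a' = a \<and> b' = b \<and> w' + 1 = w then
        of_bool (w \<ge> 1) * (mu1 * real a * p + mu2 * real b * (1 - p) + theta * real w)
      else 0)"

text \<open>
  An existential over sample spaces has to fix the type of outcomes. Sequences of reals are rich
  enough for any pair of chains with right-continuous paths (for instance via a countable
  family of independent uniform variables).
\<close>

type_synonym outcome = "nat \<Rightarrow> real"

end

theory Submission
  imports Defs
begin

text \<open>
  \<^bold>\<open>The coupling.\<close> Both queues are read off one list of jobs in order of arrival. A job carries its
  service type and a flag saying whether it is still present in the smaller system. The larger
  system consists of all jobs of the list, the smaller one of the flagged jobs; in each of them the
  first \<open>n\<close> jobs are in service, at their own rate \<open>mu1\<close> or \<open>mu2\<close>, and the others wait and abandon at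
  rate \<open>theta\<close>. An arrival appends a flagged job. When the list falls below length \<open>n\<close>, an unflagged
  job is appended: this is the extra arrival that keeps the servers of the larger system busy. So
  \<open>waiting\<close> is the length of a list minus \<open>n\<close>, respectively the length of a sublist minus \<open>n\<close>, and the
  claimed inequality holds on every path.

  What has to be checked is that the two systems can be run together. The position of a flagged job
  among the flagged jobs is at most its position in the whole list, so a job in service in the larger
  system is in service in the smaller one. As \<open>theta < min mu1 mu2\<close>, a flagged job then
  leaves the smaller system at least as fast as the larger one: let it leave both at the slower
  of the two rates, and lose only its flag at the difference.

  \<^bold>\<open>The marginals.\<close> Forgetting the order of the jobs in service and the jobs of the other system turns the
  list into a chain whose states are the two service counts and the list of types of the waiting
  jobs. This is an ordinary lumping (\<open>strong_lumping\<close>): the rates depend on the list only through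
  the image. The types of the waiting jobs cannot be dropped in this way, because they
  decide which count rises when a waiting job enters service. But given the history of the counts the waiting types remain independent coin flips, since
  arrivals append a fresh flip and abandonment is blind to types. That is an intertwining of the
  two chains by the kernel that fills in random types (\<open>intertwining\<close>, a Rogers--Pitman argument), and
  it makes the sequence of triples Markov with the prescribed rates (\<open>is_ctmc_coupled\<close>).

  \<^bold>\<open>Existence of the chains.\<close> The rates are unbounded but grow at most linearly in a level that a
  jump raises by at most one. Such a chain is run on a Yule clock: the jump that leaves index \<open>i\<close> occurs
  at rate \<open>c * (i + 1)\<close>, whatever the state, and a discrete kernel decides where to go, possibly
  nowhere. The number of jumps is then negative binomial and independent of the states visited, which
  gives the transition probabilities in closed form (\<open>renewal\<close>), excludes explosion
  (\<open>AE_At_exists\<close>), and reduces lumping and intertwining to statements about discrete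
  kernels. The index at which the clock is started does not influence the law of the state as
  long as it is at least the level (\<open>pair_kernel_index_Suc\<close>); forgetting the index therefore leaves
  a Markov semigroup, whose derivative at time zero is the generator.
\<close>

section \<open>Independent exponential clocks\<close>

definition expo :: "real measure" where
  "expo = density lborel (exponential_density 1)"

lemma space_expo [simp]: "space expo = UNIV"
  and sets_expo [simp, measurable_cong]: "sets expo = sets borel"
  by (simp_all add: expo_def)

interpretation expo: prob_space expo
  unfolding expo_def by (rule prob_space_exponential_density) simp

lemma nn_integral_expo:
  assumes [measurable]: "f \<in> borel_measurable borel"
  shows "(\<integral>\<^sup>+x. f x \<partial>expo) = (\<integral>\<^sup>+x. ennreal (exp (-x)) * f x * indicator {0..} x \<partial>lborel)"
  unfolding expo_def
  by (subst nn_integral_density)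
     (auto intro!: nn_integral_cong simp: exponential_density_def split: split_indicator)

lemma measure_expo_atLeast:
  assumes "0 \<le> a" shows "measure expo {a..} = exp (-a)"
proof -
  have "emeasure expo {..a} = ennreal (1 - exp (-a))"
    using emeasure_erlang_density[of 1 0 a] assms
    by (simp add: expo_def erlang_CDF_def)
  then have 1: "measure expo {..a} = 1 - exp (-a)"
    using assms by (simp add: measure_def)
  have "emeasure expo {a} = 0"
    unfolding expo_def by (subst emeasure_density) (auto intro!: nn_integral_null_set)
  then have 2: "measure expo {a} = 0" by (simp add: measure_def)
  have "measure expo (- {..a} \<union> {a}) = measure expo (-{..a}) + measure expo {a}"
    by (intro expo.finite_measure_Union) auto
  moreover have "- {..a} \<union> {a} = {a..}" by auto
  moreover have "measure expo (-{..a}) = 1 - measure expo {..a}"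
    using expo.prob_compl[of "{..a}"] by (simp add: Compl_eq_Diff_UNIV)
  ultimately show ?thesis using 1 2 by simp
qed

lemma AE_expo_pos: "AE x in expo. 0 < x"
  unfolding expo_def
  by (subst AE_density) (use AE_lborel_singleton[of 0] in \<open>auto simp: exponential_density_def\<close>)

text \<open>
  Absence of memory, used when a path is observed in the middle of a holding time.
\<close>

lemma nn_integral_expo_memoryless:
  assumes [measurable]: "g \<in> borel_measurable borel" and "0 \<le> b"
  shows "(\<integral>\<^sup>+e. (if b < e then g (e - b) else 0) \<partial>expo) = ennreal (exp (-b)) * (\<integral>\<^sup>+e. g e \<partial>expo)"
proof -
  have "(\<integral>\<^sup>+e. (if b < e then g (e - b) else 0) \<partial>expo) =
        (\<integral>\<^sup>+e. ennreal (exp (-e)) * (if b < e then g (e - b) else 0) * indicator {0..} e \<partial>lborel)"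
    by (rule nn_integral_expo) measurable
  also have "\<dots> = (\<integral>\<^sup>+v. ennreal (exp (-(b + 1 * v))) * (if b < b + 1 * v then g (b + 1 * v - b) else 0) * indicator {0..} (b + 1 * v) \<partial>lborel)"
    by (subst nn_integral_real_affine[where c = 1 and t = b]) auto
  also have "\<dots> = (\<integral>\<^sup>+v. ennreal (exp (-b)) * (ennreal (exp (-v)) * g v * indicator {0..} v) \<partial>lborel)"
  proof (rule nn_integral_cong_AE)
    have split: "ennreal (exp (- b - v)) = ennreal (exp (-b)) * ennreal (exp (-v))" for v
      by (simp add: ennreal_mult[symmetric] mult_exp_exp)
    show "AE v in lborel. ennreal (exp (-(b + 1 * v))) * (if b < b + 1 * v then g (b + 1 * v - b) else 0) * indicator {0..} (b + 1 * v) =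
      ennreal (exp (-b)) * (ennreal (exp (-v)) * g v * indicator {0..} v)"
      using AE_lborel_singleton[of "0::real"]
      by eventually_elim (use assms(2) in \<open>auto simp: split mult_ac split: split_indicator\<close>)
  qed
  also have "\<dots> = ennreal (exp (-b)) * (\<integral>\<^sup>+e. g e \<partial>expo)"
    by (subst nn_integral_cmult) (auto simp: nn_integral_expo)
  finally show ?thesis .
qed

text \<open>
  Coordinate \<open>2 * m\<close> will determine the holding time before jump \<open>m\<close>, counted from \<open>0\<close>, and coordinate
  \<open>2 * m + 1\<close> its target. One common law for all coordinates makes the space invariant under dropping a prefix.
\<close>

definition clocks :: "outcome measure" where
  "clocks = Pi\<^sub>M UNIV (\<lambda>_. expo)"

interpretation clock_seq: sequence_space expo by unfold_locales

interpretation clocks: prob_space clocks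
  unfolding clocks_def by (rule clock_seq.prob_space_axioms)

lemma space_clocks [simp]: "space clocks = UNIV"
  by (simp add: clocks_def space_PiM)

lemma sets_clocks [measurable_cong]: "sets clocks = sets (Pi\<^sub>M UNIV (\<lambda>_::nat. borel :: real measure))"
  unfolding clocks_def by (intro sets_PiM_cong) auto

lemma measurable_clocks_component [measurable]: "(\<lambda>\<omega>. \<omega> n) \<in> borel_measurable clocks"
  by measurable

lemma measurable_case_nat_clocks [measurable]:
  assumes [measurable]: "f \<in> borel_measurable N" "g \<in> measurable N clocks"
  shows "(\<lambda>x. case_nat (f x) (g x)) \<in> measurable N clocks"
proof -
  have "(\<lambda>x. case_nat (f x) (g x)) \<in> measurable N (Pi\<^sub>M UNIV (\<lambda>_::nat. borel))"
    by (rule measurable_case_nat') (use assms in \<open>auto simp: measurable_cong_sets[OF refl sets_clocks]\<close>)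
  then show ?thesis by (simp add: measurable_cong_sets[OF refl sets_clocks])
qed

lemma nn_integral_clocks_iter:
  assumes [measurable]: "f \<in> borel_measurable clocks"
  shows "(\<integral>\<^sup>+\<omega>. f \<omega> \<partial>clocks) = (\<integral>\<^sup>+e. \<integral>\<^sup>+\<omega>. f (case_nat e \<omega>) \<partial>clocks \<partial>expo)"
proof -
  have "clocks = distr (expo \<Otimes>\<^sub>M clocks) clocks (\<lambda>(s, \<omega>). case_nat s \<omega>)"
    using clock_seq.PiM_iter unfolding clocks_def by simp
  then have "(\<integral>\<^sup>+\<omega>. f \<omega> \<partial>clocks) = (\<integral>\<^sup>+\<omega>. f \<omega> \<partial>distr (expo \<Otimes>\<^sub>M clocks) clocks (\<lambda>(s, \<omega>). case_nat s \<omega>))"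
    by simp
  also have "\<dots> = (\<integral>\<^sup>+x. f (case x of (s, \<omega>) \<Rightarrow> case_nat s \<omega>) \<partial>(expo \<Otimes>\<^sub>M clocks))"
    by (rule nn_integral_distr) measurable
  also have "\<dots> = (\<integral>\<^sup>+e. \<integral>\<^sup>+\<omega>. f (case_nat e \<omega>) \<partial>clocks \<partial>expo)"
    by (subst clocks.nn_integral_fst[symmetric]) (auto simp: case_prod_beta)
  finally show ?thesis .
qed

lemma emeasure_clocks_case_nat:
  assumes [measurable]: "Measurable.pred clocks P"
  shows "(\<integral>\<^sup>+\<omega>. indicator {\<omega>. P \<omega>} (case_nat e (case_nat u \<omega>)) \<partial>clocks) =
    emeasure clocks {\<omega>. P (case_nat e (case_nat u \<omega>))}"
proof -
  have "Measurable.pred clocks (\<lambda>\<omega>. P (case_nat e (case_nat u \<omega>)))" by measurable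
  then have m: "{\<omega>. P (case_nat e (case_nat u \<omega>))} \<in> sets clocks" by (simp add: pred_def)
  have "(\<integral>\<^sup>+\<omega>. indicator {\<omega>. P \<omega>} (case_nat e (case_nat u \<omega>)) \<partial>clocks) =
    (\<integral>\<^sup>+\<omega>. indicator {\<omega>. P (case_nat e (case_nat u \<omega>))} \<omega> \<partial>clocks)"
    by (intro nn_integral_cong) (simp split: split_indicator)
  then show ?thesis using m by simp
qed

text \<open>
  The first two coordinates carry the first jump, and the remaining ones are again a sequence of
  clocks; arguments by induction on the number of jumps rest on this.
\<close>

lemma emeasure_clocks_iter:
  assumes [measurable]: "Measurable.pred clocks P"
  shows "emeasure clocks {\<omega>. P \<omega>} =
    (\<integral>\<^sup>+e. \<integral>\<^sup>+u. emeasure clocks {\<omega>. P (case_nat e (case_nat u \<omega>))} \<partial>expo \<partial>expo)"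
proof -
  have [measurable]: "{\<omega>. P \<omega>} \<in> sets clocks"
    using assms by (simp add: pred_def)
  have "emeasure clocks {\<omega>. P \<omega>} = (\<integral>\<^sup>+\<omega>. indicator {\<omega>. P \<omega>} \<omega> \<partial>clocks)" by simp
  also have "\<dots> = (\<integral>\<^sup>+e. \<integral>\<^sup>+u. \<integral>\<^sup>+\<omega>. indicator {\<omega>. P \<omega>} (case_nat e (case_nat u \<omega>)) \<partial>clocks \<partial>expo \<partial>expo)"
    by (subst nn_integral_clocks_iter, simp, subst nn_integral_clocks_iter) auto
  also have "\<dots> = (\<integral>\<^sup>+e. \<integral>\<^sup>+u. emeasure clocks {\<omega>. P (case_nat e (case_nat u \<omega>))} \<partial>expo \<partial>expo)"
    by (simp add: emeasure_clocks_case_nat)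
  finally show ?thesis .
qed

lemma AE_clocks_pos: "AE \<omega> in clocks. \<forall>l. 0 < \<omega> l"
proof -
  have "AE \<omega> in clocks. 0 < \<omega> l" for l
    unfolding clocks_def using AE_expo_pos
    by (intro AE_PiM_component) (auto intro: expo.prob_space_axioms)
  then show ?thesis by (simp add: AE_all_countable)
qed

text \<open>
  Inverse transform sampling: \<open>1 - exp (-u)\<close> is the distribution function of the clock \<open>u\<close>, hence is
  uniform on the unit interval.
\<close>

definition sample :: "'s::countable pmf \<Rightarrow> real \<Rightarrow> 's" where
  "sample D u = from_nat (LEAST k. 1 - exp (-u) < (\<Sum>l\<le>k. pmf (map_pmf to_nat D) l))"

lemma measurable_sample [measurable]: "sample D \<in> measurable borel (count_space UNIV)"
  unfolding sample_def by measurable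

lemma distr_sample: "distr expo (count_space UNIV) (sample D) = measure_pmf D"
proof -
  define q where "q = map_pmf to_nat D"
  define A where "A k = measure_pmf.prob q {..k}" for k
  define L where "L u = (LEAST k. 1 - exp (-u) < A k)" for u :: real
  have A_sum: "A k = (\<Sum>l\<le>k. pmf q l)" for k
    unfolding A_def by (rule measure_measure_pmf_finite) auto
  have [measurable]: "L \<in> measurable borel (count_space UNIV)"
    unfolding L_def by measurable
  have A_mono: "A j \<le> A k" if "j \<le> k" for j k
    unfolding A_def using that by (intro measure_pmf.finite_measure_mono) auto
  have "(\<lambda>k. A k) \<longlonglongrightarrow> measure_pmf.prob q (\<Union>k. {..k})"
    unfolding A_def by (rule measure_pmf.finite_Lim_measure_incseq) (auto simp: incseq_def)
  moreover have "(\<Union>k::nat. {..k}) = UNIV" by auto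
  ultimately have A_lim: "A \<longlonglongrightarrow> 1" by simp
  have ex: "\<exists>k. 1 - exp (-u) < A k" for u :: real
  proof -
    have "eventually (\<lambda>k. 1 - exp (-u) < A k) sequentially"
      by (rule order_tendstoD[OF A_lim]) simp
    then show ?thesis by (auto simp: eventually_sequentially)
  qed
  have L_le: "L u \<le> k \<longleftrightarrow> 1 - exp (-u) < A k" for u k
  proof
    assume "L u \<le> k"
    moreover have "1 - exp (-u) < A (L u)" unfolding L_def by (rule LeastI_ex[OF ex])
    ultimately show "1 - exp (-u) < A k" using A_mono by (meson less_le_trans)
  qed (auto simp: L_def intro: Least_le)
  have prob_le: "measure expo {u. L u \<le> k} = A k" for k
  proof (cases "A k < 1")
    case True
    have A0: "0 \<le> A k" by (simp add: A_def)
    let ?b = "- ln (1 - A k)"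
    have b: "0 \<le> ?b" using True A0 by simp
    have iff: "1 - exp (-u) < A k \<longleftrightarrow> u < ?b" for u :: real
    proof -
      have "1 - exp (-u) < A k \<longleftrightarrow> 1 - A k < exp (-u)" by linarith
      also have "\<dots> \<longleftrightarrow> ln (1 - A k) < -u"
        using True by (metis diff_gt_0_iff_gt exp_ln exp_less_cancel_iff)
      finally show ?thesis by linarith
    qed
    have "{u. L u \<le> k} = UNIV - {?b..}"
      using L_le iff by auto
    then have "measure expo {u. L u \<le> k} = 1 - measure expo {?b..}"
      using expo.prob_compl[of "{?b..}"] by simp
    also have "measure expo {?b..} = 1 - A k"
      using b True by (subst measure_expo_atLeast) auto
    finally show ?thesis by simp
  next
    case False
    then have "A k = 1" by (simp add: A_def order_antisym)
    moreover have "{u. L u \<le> k} = UNIV" using L_le \<open>A k = 1\<close> by auto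
    ultimately show ?thesis using expo.prob_space by simp
  qed
  have prob_eq: "measure expo {u. L u = k} = pmf q k" for k
  proof (cases k)
    case 0
    then show ?thesis using prob_le[of 0] by (simp add: A_sum)
  next
    case (Suc j)
    have "{u. L u \<le> k} - {u. L u \<le> j} = {u. L u = k}" using Suc by auto
    moreover have "{u. L u \<le> j} \<subseteq> {u. L u \<le> k}" using Suc by auto
    ultimately have "measure expo {u. L u = k} = A k - A j"
      using expo.finite_measure_Diff[of "{u. L u \<le> k}" "{u. L u \<le> j}"] prob_le by simp
    then show ?thesis by (simp add: A_sum Suc)
  qed
  have "distr expo (count_space UNIV) L = measure_pmf q"
  proof (rule measure_eqI_countable[where A = UNIV])
    fix a :: nat
    have "emeasure (distr expo (count_space UNIV) L) {a} = emeasure expo {u. L u = a}"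
      by (subst emeasure_distr) (auto simp: vimage_def measurable_cong_sets[OF sets_expo refl])
    then show "emeasure (distr expo (count_space UNIV) L) {a} = emeasure (measure_pmf q) {a}"
      using prob_eq[of a] by (simp add: expo.emeasure_eq_measure emeasure_pmf_single)
  qed auto
  then have "distr (distr expo (count_space UNIV) L) (count_space UNIV) from_nat = measure_pmf (map_pmf from_nat q)"
    by (simp add: map_pmf_rep_eq)
  also have "map_pmf from_nat q = D"
    by (simp add: q_def map_pmf_comp)
  finally show ?thesis
    by (subst (asm) distr_distr) (auto simp: measurable_cong_sets[OF sets_expo refl] sample_def[abs_def] L_def[abs_def] A_sum q_def comp_def)
qed

lemma nn_integral_sample: "(\<integral>\<^sup>+u. f (sample D u) \<partial>expo) = (\<integral>\<^sup>+y. f y \<partial>measure_pmf D)"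
  unfolding distr_sample[symmetric] by (subst nn_integral_distr) (auto simp: measurable_cong_sets[OF sets_expo refl])

section \<open>A chain driven by a Yule clock\<close>

text \<open>
  The clock moves from index \<open>i\<close> to \<open>i + 1\<close> at rate \<open>c * (i + 1)\<close>, and this jump moves the state with
  the kernel \<open>K i\<close>. Because the rate ignores the state, the clock is independent of the states visited.
\<close>

locale yule_chain =
  fixes c :: real and K :: "nat \<Rightarrow> 's::countable \<Rightarrow> 's pmf"
  assumes c_pos: "c > 0"
begin

definition jump_time :: "nat \<Rightarrow> nat \<Rightarrow> outcome \<Rightarrow> real" where
  "jump_time i m \<omega> = (\<Sum>l<m. \<omega> (2 * l) / (c * real (Suc (i + l))))"

primrec skeleton :: "nat \<Rightarrow> 's \<Rightarrow> nat \<Rightarrow> outcome \<Rightarrow> 's" where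
  "skeleton i x 0 \<omega> = x"
| "skeleton i x (Suc m) \<omega> = sample (K (i + m) (skeleton i x m \<omega>)) (\<omega> (Suc (2 * m)))"

text \<open>
  The clock-state pair started at \<open>z\<close> is at \<open>w\<close> at time \<open>t\<close>. This is a relation, since a pair at time
  \<open>t\<close> exists only on paths that do not explode before \<open>t\<close>.
\<close>

definition At :: "nat \<times> 's \<Rightarrow> real \<Rightarrow> nat \<times> 's \<Rightarrow> outcome \<Rightarrow> bool" where
  "At z t w \<omega> \<longleftrightarrow> fst z \<le> fst w \<and>
     jump_time (fst z) (fst w - fst z) \<omega> \<le> t \<and> t < jump_time (fst z) (Suc (fst w - fst z)) \<omega> \<and>
     skeleton (fst z) (snd z) (fst w - fst z) \<omega> = snd w"

lemma measurable_jump_time [measurable]: "jump_time i m \<in> borel_measurable clocks"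
  unfolding jump_time_def[abs_def] by measurable

lemma measurable_skeleton [measurable]: "skeleton i x m \<in> measurable clocks (count_space UNIV)"
proof (induction m)
  case (Suc m)
  note [measurable] = Suc
  show ?case unfolding skeleton.simps
    by (rule measurable_compose_countable[OF _ Suc]) measurable
qed simp

lemma pred_At_param [measurable]:
  assumes [measurable]: "\<tau> \<in> borel_measurable N" "f \<in> measurable N clocks"
  shows "Measurable.pred N (\<lambda>y. At z (\<tau> y) w (f y))"
  unfolding At_def by measurable

lemma jump_time_Suc:
  "jump_time i (Suc m) (case_nat e (case_nat u \<omega>)) = e / (c * real (Suc i)) + jump_time (Suc i) m \<omega>"
  unfolding jump_time_def by (subst sum.lessThan_Suc_shift) simp

lemma jump_time_0 [simp]: "jump_time i 0 \<omega> = 0"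
  by (simp add: jump_time_def)

lemma skeleton_Suc:
  "skeleton i x (Suc m) (case_nat e (case_nat u \<omega>)) = skeleton (Suc i) (sample (K i x) u) m \<omega>"
  by (induction m) simp_all

lemma jump_time_nonneg: "(\<forall>l. 0 < \<omega> l) \<Longrightarrow> 0 \<le> jump_time i m \<omega>"
  unfolding jump_time_def using c_pos by (intro sum_nonneg divide_nonneg_nonneg) (auto intro: less_imp_le)

lemma jump_time_mono: "(\<forall>l. 0 < \<omega> l) \<Longrightarrow> m \<le> m' \<Longrightarrow> jump_time i m \<omega> \<le> jump_time i m' \<omega>"
  unfolding jump_time_def using c_pos
  by (intro sum_mono2 divide_nonneg_nonneg) (auto intro: less_imp_le)

lemma At_unique:
  assumes "At z t w \<omega>" "At z t w' \<omega>" "\<forall>l. 0 < \<omega> l"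
  shows "w = w'"
proof -
  have "fst w - fst z = fst w' - fst z"
  proof (rule ccontr)
    assume "fst w - fst z \<noteq> fst w' - fst z"
    then consider "Suc (fst w - fst z) \<le> fst w' - fst z" | "Suc (fst w' - fst z) \<le> fst w - fst z"
      by linarith
    then show False
      using jump_time_mono[OF assms(3), of "Suc (fst w - fst z)" "fst w' - fst z" "fst z"]
        jump_time_mono[OF assms(3), of "Suc (fst w' - fst z)" "fst w - fst z" "fst z"] assms(1,2)
      by cases (auto simp: At_def)
  qed
  then show ?thesis using assms(1,2) by (auto simp: At_def prod_eq_iff)
qed

text \<open>
  Before the first jump nothing has happened; after it, the path is that of the remaining clocks,
  started from the next pair.
\<close>

lemma At_iter:
  assumes "0 \<le> t" "\<forall>l. 0 < \<omega> l"
  shows "At (i, x) t w (case_nat e (case_nat u \<omega>)) \<longleftrightarrow>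
    (if t < e / (c * real (Suc i)) then w = (i, x)
     else At (Suc i, sample (K i x) u) (t - e / (c * real (Suc i))) w \<omega>)"
proof (cases "i < fst w")
  case False
  then show ?thesis
    using assms(1) jump_time_Suc[of i 0 e u \<omega>] by (auto simp: At_def prod_eq_iff)
next
  case True
  then obtain m where m: "fst w - i = Suc m" by (metis Suc_diff_Suc)
  have m': "fst w - Suc i = m" using m by simp
  have "0 \<le> jump_time (Suc i) m \<omega>" by (rule jump_time_nonneg[OF assms(2)])
  then show ?thesis
    using True by (auto simp del: skeleton.simps simp add: At_def m m' jump_time_Suc skeleton_Suc prod_eq_iff)
qed

text \<open>
  The list prescribes where the path has to be at the times \<open>t + s\<close>, that is, after \<open>t\<close>.
\<close>

definition hits :: "nat \<times> 's \<Rightarrow> real \<Rightarrow> (real \<times> nat \<times> 's) list \<Rightarrow> outcome \<Rightarrow> bool" where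
  "hits z t l \<omega> \<longleftrightarrow> (\<forall>(s, w)\<in>set l. At z (t + s) w \<omega>)"

lemma pred_hits [measurable]:
  assumes [measurable]: "\<tau> \<in> borel_measurable N" "f \<in> measurable N clocks"
  shows "Measurable.pred N (\<lambda>y. hits z (\<tau> y) l (f y))"
  unfolding hits_def case_prod_beta by measurable

lemma sets_hits [measurable]: "{\<omega>. At z t w \<omega> \<and> hits z t l \<omega>} \<in> sets clocks" "{\<omega>. hits z t l \<omega>} \<in> sets clocks"
proof -
  have "Measurable.pred clocks (\<lambda>\<omega>. At z t w \<omega> \<and> hits z t l \<omega>)" "Measurable.pred clocks (\<lambda>\<omega>. hits z t l \<omega>)"
    by measurable
  then show "{\<omega>. At z t w \<omega> \<and> hits z t l \<omega>} \<in> sets clocks" "{\<omega>. hits z t l \<omega>} \<in> sets clocks"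
    by (simp_all add: pred_def)
qed

lemma emeasure_clocks_AE_cong:
  assumes "\<And>\<omega>. (\<forall>l. 0 < \<omega> l) \<Longrightarrow> P \<omega> \<longleftrightarrow> P' \<omega>"
    and "Measurable.pred clocks P" "Measurable.pred clocks P'"
  shows "emeasure clocks {\<omega>. P \<omega>} = emeasure clocks {\<omega>. P' \<omega>}"
  using AE_clocks_pos assms by (intro emeasure_eq_AE) (auto simp: pred_def)

text \<open>
  Decomposition of an event about the path at and after time \<open>t\<close> according to whether the first
  jump is later than \<open>t\<close>.
\<close>

lemma emeasure_hits_iter:
  assumes t: "0 \<le> t" and s: "\<forall>(s, w)\<in>set l. 0 \<le> s"
  shows "emeasure clocks {\<omega>. At (i, x) t w \<omega> \<and> hits (i, x) t l \<omega>} =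
    (\<integral>\<^sup>+e. \<integral>\<^sup>+u. (if t < e / (c * real (Suc i))
       then if w = (i, x) then emeasure clocks {\<omega>. hits (i, x) t l (case_nat e (case_nat u \<omega>))} else 0
       else emeasure clocks {\<omega>. At (Suc i, sample (K i x) u) (t - e / (c * real (Suc i))) w \<omega> \<and>
              hits (Suc i, sample (K i x) u) (t - e / (c * real (Suc i))) l \<omega>}) \<partial>expo \<partial>expo)"
proof -
  have "emeasure clocks {\<omega>. At (i, x) t w \<omega> \<and> hits (i, x) t l \<omega>} =
     (\<integral>\<^sup>+e. \<integral>\<^sup>+u. emeasure clocks {\<omega>. At (i, x) t w (case_nat e (case_nat u \<omega>)) \<and>
        hits (i, x) t l (case_nat e (case_nat u \<omega>))} \<partial>expo \<partial>expo)"
    by (rule emeasure_clocks_iter) measurable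
  also have "\<dots> = (\<integral>\<^sup>+e. \<integral>\<^sup>+u. (if t < e / (c * real (Suc i))
       then if w = (i, x) then emeasure clocks {\<omega>. hits (i, x) t l (case_nat e (case_nat u \<omega>))} else 0
       else emeasure clocks {\<omega>. At (Suc i, sample (K i x) u) (t - e / (c * real (Suc i))) w \<omega> \<and>
              hits (Suc i, sample (K i x) u) (t - e / (c * real (Suc i))) l \<omega>}) \<partial>expo \<partial>expo)"
  proof (intro nn_integral_cong)
    fix e u :: real
    let ?L = "c * real (Suc i)" and ?P = "\<lambda>\<omega>. case_nat e (case_nat u \<omega>)"
    show "emeasure clocks {\<omega>. At (i, x) t w (?P \<omega>) \<and> hits (i, x) t l (?P \<omega>)} =
      (if t < e / ?L
       then if w = (i, x) then emeasure clocks {\<omega>. hits (i, x) t l (?P \<omega>)} else 0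
       else emeasure clocks {\<omega>. At (Suc i, sample (K i x) u) (t - e / ?L) w \<omega> \<and>
              hits (Suc i, sample (K i x) u) (t - e / ?L) l \<omega>})"
    proof (cases "t < e / ?L")
      case True
      have "emeasure clocks {\<omega>. At (i, x) t w (?P \<omega>) \<and> hits (i, x) t l (?P \<omega>)} =
         emeasure clocks {\<omega>. w = (i, x) \<and> hits (i, x) t l (?P \<omega>)}"
        by (rule emeasure_clocks_AE_cong) (use True in \<open>auto simp: At_iter[OF t]\<close>)
      then show ?thesis using True by auto
    next
      case False
      have "emeasure clocks {\<omega>. At (i, x) t w (?P \<omega>) \<and> hits (i, x) t l (?P \<omega>)} =
         emeasure clocks {\<omega>. At (Suc i, sample (K i x) u) (t - e / ?L) w \<omega> \<and>
              hits (Suc i, sample (K i x) u) (t - e / ?L) l \<omega>}"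
      proof (rule emeasure_clocks_AE_cong)
        fix \<omega> :: outcome assume pos: "\<forall>l. 0 < \<omega> l"
        have "At (i, x) (t + s) w' (?P \<omega>) \<longleftrightarrow> At (Suc i, sample (K i x) u) (t - e / ?L + s) w' \<omega>"
          if "0 \<le> s" for s w'
          using that False t by (subst At_iter[OF _ pos]) (auto simp: algebra_simps)
        then have "hits (i, x) t l (?P \<omega>) = hits (Suc i, sample (K i x) u) (t - e / ?L) l \<omega>"
          unfolding hits_def using s by (intro ball_cong refl) (simp add: case_prod_beta)
        then show "(At (i, x) t w (?P \<omega>) \<and> hits (i, x) t l (?P \<omega>)) =
          (At (Suc i, sample (K i x) u) (t - e / ?L) w \<omega> \<and> hits (Suc i, sample (K i x) u) (t - e / ?L) l \<omega>)"
          using False by (simp add: At_iter[OF t pos])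
      qed measurable
      then show ?thesis using False by simp
    qed
  qed
  finally show ?thesis .
qed

end

text \<open>
  The probability of exactly \<open>m\<close> jumps up to time \<open>t\<close> from index \<open>i\<close>: \<open>m\<close> failures before the
  \<open>i + 1\<close>-st success, when a success has probability \<open>exp (- c * t)\<close>.
\<close>

definition yule_prob :: "real \<Rightarrow> nat \<Rightarrow> nat \<Rightarrow> real \<Rightarrow> real" where
  "yule_prob c i m t = real (i + m choose m) * exp (- (c * real (Suc i) * t)) * (1 - exp (- (c * t))) ^ m"

lemma pmf_yule:
  assumes "0 < c" "0 \<le> t"
  shows "pmf (neg_binomial_pmf (Suc i) (exp (- (c * t)))) m = yule_prob c i m t"
proof -
  have "exp (- (c * real (Suc i) * t)) = exp (- (c * t)) ^ Suc i"
    by (subst exp_of_nat_mult[symmetric]) (simp add: algebra_simps)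
  then show ?thesis
    using assms by (subst pmf_neg_binomial) (auto simp: yule_prob_def add_ac simp del: power_Suc)
qed

lemma yule_prob_nonneg: "0 < c \<Longrightarrow> 0 \<le> t \<Longrightarrow> 0 \<le> yule_prob c i m t"
  by (auto simp: yule_prob_def)

lemma measurable_yule_prob [measurable]:
  assumes [measurable]: "f \<in> borel_measurable N"
  shows "(\<lambda>y. yule_prob c i m (f y)) \<in> borel_measurable N"
  unfolding yule_prob_def by measurable

lemma choose_Suc_shift:
  "real (i + Suc m choose Suc m) * real (Suc m) = real (Suc i + m choose m) * real (Suc i)"
proof -
  have "Suc m * (Suc (i + m) choose Suc m) = Suc (i + m) * (i + m choose m)"
    using binomial_absorption[of m "Suc (i + m)"] by (simp only: diff_Suc_1)
  moreover have "Suc i * (Suc (i + m) choose m) = Suc (i + m) * (i + m choose m)"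
    using binomial_absorb_comp[of "Suc (i + m)" m] by (simp only: diff_Suc_1) simp
  ultimately have "(i + Suc m choose Suc m) * Suc m = (Suc i + m choose m) * Suc i"
    by (metis mult.commute add_Suc add_Suc_right)
  then show ?thesis by (metis of_nat_mult)
qed

text \<open>
  Conditioning on the first jump time. Together with the exponential density the integrand is, up to a
  constant, the \<open>m\<close>-th power of \<open>1 - exp (- c * (t - e / L))\<close> times the derivative of this function of \<open>e\<close>.
\<close>

lemma yule_prob_iter:
  fixes i m :: nat
  assumes c: "0 < c" and t: "0 \<le> t"
  defines "L \<equiv> c * real (Suc i)"
  shows "(\<integral>\<^sup>+e. (if t < e / L then 0 else ennreal (yule_prob c (Suc i) m (t - e / L))) \<partial>expo) =
    ennreal (yule_prob c i (Suc m) t)"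
proof -
  have L: "L > 0" using c by (simp add: L_def)
  define F where "F e = - real (i + Suc m choose Suc m) * exp (- (L * t)) * (1 - exp (- (c * (t - e / L)))) ^ Suc m" for e
  define f where "f e = exp (- e) * yule_prob c (Suc i) m (t - e / L)" for e
  note binom = choose_Suc_shift[of i m]
  have deriv: "(F has_real_derivative f e) (at e)" for e
  proof -
    have "(F has_real_derivative
       (- real (i + Suc m choose Suc m) * exp (- (L * t)) *
         (real (Suc m) * (1 - exp (- (c * (t - e / L)))) ^ m * (- (exp (- (c * (t - e / L))) * (c / L)))))) (at e)"
      unfolding F_def[abs_def] using L
      by (auto intro!: derivative_eq_intros simp del: power_Suc)
    also have "(- real (i + Suc m choose Suc m) * exp (- (L * t)) *
         (real (Suc m) * (1 - exp (- (c * (t - e / L)))) ^ m * (- (exp (- (c * (t - e / L))) * (c / L))))) =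
        (real (i + Suc m choose Suc m) * real (Suc m)) * (c / L) * (exp (- (L * t)) * exp (- (c * (t - e / L)))) * (1 - exp (- (c * (t - e / L)))) ^ m"
      by (simp add: mult_ac del: binomial_Suc_Suc of_nat_Suc)
    also have "\<dots> = real (Suc i + m choose m) * (exp (- (L * t)) * exp (- (c * (t - e / L)))) * (1 - exp (- (c * (t - e / L)))) ^ m"
      unfolding binom using c by (simp add: L_def)
    also have "exp (- (L * t)) * exp (- (c * (t - e / L))) = exp (- e) * exp (- (c * real (Suc (Suc i)) * (t - e / L)))"
    proof -
      have "c * real (Suc (Suc i)) = L + c" by (simp add: L_def algebra_simps)
      then have "c * real (Suc (Suc i)) * (t - e / L) = L * (t - e / L) + c * (t - e / L)"
        by (simp only: distrib_right)
      moreover have "L * (t - e / L) = L * t - e" using L by (simp add: field_simps)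
      ultimately show ?thesis unfolding mult_exp_exp by simp
    qed
    finally show ?thesis by (simp add: f_def yule_prob_def mult_ac)
  qed
  have [measurable]: "f \<in> borel_measurable borel"
    unfolding f_def[abs_def] by measurable
  have "(\<integral>\<^sup>+e. (if t < e / L then 0 else ennreal (yule_prob c (Suc i) m (t - e / L))) \<partial>expo) =
    (\<integral>\<^sup>+e. ennreal (exp (- e)) * (if t < e / L then 0 else ennreal (yule_prob c (Suc i) m (t - e / L))) * indicator {0..} e \<partial>lborel)"
    by (rule nn_integral_expo) measurable
  also have "\<dots> = (\<integral>\<^sup>+e. ennreal (f e) * indicator {0..L * t} e \<partial>lborel)"
    using L by (intro nn_integral_cong) (auto simp: f_def field_simps ennreal_mult' split: split_indicator)
  also have "\<dots> = ennreal (F (L * t) - F 0)"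
  proof (rule nn_integral_FTC_Icc)
    show "DERIV F e :> f e" for e
      by (rule deriv)
    show "0 \<le> f e" if "e \<in> {0..L * t}" for e
      using that c L by (auto simp: f_def field_simps intro!: mult_nonneg_nonneg yule_prob_nonneg)
  qed (use L t in auto)
  also have "F (L * t) - F 0 = yule_prob c i (Suc m) t"
    using L c by (simp add: F_def yule_prob_def L_def del: binomial_Suc_Suc of_nat_Suc)
  finally show ?thesis .
qed

context yule_chain
begin

primrec steps :: "nat \<Rightarrow> nat \<Rightarrow> 's \<Rightarrow> 's pmf" where
  "steps 0 i x = return_pmf x"
| "steps (Suc m) i x = bind_pmf (K i x) (steps m (Suc i))"

lemma measurable_emeasure_hits [measurable]:
  "(\<lambda>e. \<integral>\<^sup>+u. emeasure clocks {\<omega>. hits z t l (case_nat e (case_nat u \<omega>))} \<partial>expo) \<in> borel_measurable borel"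
proof -
  have "(\<lambda>e. \<integral>\<^sup>+u. \<integral>\<^sup>+\<omega>. indicator {\<omega>. hits z t l \<omega>} (case_nat e (case_nat u \<omega>)) \<partial>clocks \<partial>expo) \<in> borel_measurable borel"
    by measurable
  then show ?thesis
    by (subst (asm) emeasure_clocks_case_nat) measurable
qed

text \<open>
  If no jump occurs before \<open>t\<close>, the residual holding time is again exponential, so the path after \<open>t\<close>
  is a fresh path from the same pair.
\<close>

lemma emeasure_stay:
  assumes t: "0 \<le> t" and s: "\<forall>(s, w)\<in>set l. 0 \<le> s"
  shows "emeasure clocks {\<omega>. At (i, x) t (i, y) \<omega> \<and> hits (i, x) t l \<omega>} =
    ennreal (yule_prob c i 0 t * pmf (return_pmf x) y) * emeasure clocks {\<omega>. hits (i, y) 0 l \<omega>}"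
proof (cases "y = x")
  case False
  then have "\<not> At (i, x) t (i, y) \<omega>" for \<omega> by (auto simp: At_def)
  then show ?thesis using False by (simp add: pmf_return)
next
  case True
  let ?L = "c * real (Suc i)" and ?P = "\<lambda>e u \<omega>. case_nat e (case_nat u \<omega>) :: outcome"
  have L: "?L > 0" using c_pos by simp
  have never: "\<not> At (Suc i, x') \<tau> (i, y') \<omega>" for x' y' \<tau> \<omega> by (auto simp: At_def)
  have lt: "t < e / ?L \<longleftrightarrow> ?L * t < e" for e using L by (simp add: field_simps)
  have "emeasure clocks {\<omega>. At (i, x) t (i, y) \<omega> \<and> hits (i, x) t l \<omega>} =
    (\<integral>\<^sup>+e. \<integral>\<^sup>+u. (if ?L * t < e then emeasure clocks {\<omega>. hits (i, x) t l (?P e u \<omega>)} else 0) \<partial>expo \<partial>expo)"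
    using True by (subst emeasure_hits_iter[OF t s]) (simp add: never lt cong: if_cong del: of_nat_Suc)
  also have "\<dots> = (\<integral>\<^sup>+e. (if ?L * t < e then \<integral>\<^sup>+u. emeasure clocks {\<omega>. hits (i, x) 0 l (?P (e - ?L * t) u \<omega>)} \<partial>expo else 0) \<partial>expo)"
  proof (intro nn_integral_cong)
    fix e :: real
    show "(\<integral>\<^sup>+u. (if ?L * t < e then emeasure clocks {\<omega>. hits (i, x) t l (?P e u \<omega>)} else 0) \<partial>expo) =
      (if ?L * t < e then \<integral>\<^sup>+u. emeasure clocks {\<omega>. hits (i, x) 0 l (?P (e - ?L * t) u \<omega>)} \<partial>expo else 0)"
    proof (cases "?L * t < e")
      case lt: True
      have "emeasure clocks {\<omega>. hits (i, x) t l (?P e u \<omega>)} = emeasure clocks {\<omega>. hits (i, x) 0 l (?P (e - ?L * t) u \<omega>)}" for u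
      proof (rule emeasure_clocks_AE_cong)
        fix \<omega> :: outcome assume pos: "\<forall>l. 0 < \<omega> l"
        have *: "(e - ?L * t) / ?L = e / ?L - t" using L by (simp add: field_simps)
        have "At (i, x) (t + s) w' (?P e u \<omega>) \<longleftrightarrow> At (i, x) s w' (?P (e - ?L * t) u \<omega>)"
          if "0 \<le> s" for s w'
          using that t by (simp add: At_iter[OF _ pos] * less_diff_eq diff_diff_eq2 add.commute del: of_nat_Suc)
        then show "hits (i, x) t l (?P e u \<omega>) = hits (i, x) 0 l (?P (e - ?L * t) u \<omega>)"
          unfolding hits_def using s by (intro ball_cong refl) (simp add: case_prod_beta)
      qed measurable
      then show ?thesis using lt by simp
    qed simp
  qed
  also have "\<dots> = ennreal (exp (- (?L * t))) * (\<integral>\<^sup>+e. \<integral>\<^sup>+u. emeasure clocks {\<omega>. hits (i, x) 0 l (?P e u \<omega>)} \<partial>expo \<partial>expo)"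
    using L t by (intro nn_integral_expo_memoryless) auto
  also have "(\<integral>\<^sup>+e. \<integral>\<^sup>+u. emeasure clocks {\<omega>. hits (i, x) 0 l (?P e u \<omega>)} \<partial>expo \<partial>expo) = emeasure clocks {\<omega>. hits (i, x) 0 l \<omega>}"
    by (rule emeasure_clocks_iter[symmetric]) measurable
  finally show ?thesis using True by (simp add: yule_prob_def)
qed

text \<open>
  The Markov property of the clock-state pair and its transition probabilities are obtained by the same
  induction on the number \<open>m\<close> of jumps, each step of which is the first-jump decomposition.
\<close>

theorem renewal:
  assumes "0 \<le> t" and s: "\<forall>(s, w)\<in>set l. 0 \<le> s"
  shows "emeasure clocks {\<omega>. At (i, x) t (i + m, y) \<omega> \<and> hits (i, x) t l \<omega>} =
    ennreal (yule_prob c i m t * pmf (steps m i x) y) * emeasure clocks {\<omega>. hits (i + m, y) 0 l \<omega>}"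
  using assms(1)
proof (induction m arbitrary: i x t)
  case 0
  then show ?case using emeasure_stay[OF 0 s] by simp
next
  case (Suc m)
  let ?L = "c * real (Suc i)" and ?H = "emeasure clocks {\<omega>. hits (i + Suc m, y) 0 l \<omega>}"
  have "emeasure clocks {\<omega>. At (i, x) t (i + Suc m, y) \<omega> \<and> hits (i, x) t l \<omega>} =
    (\<integral>\<^sup>+e. \<integral>\<^sup>+u. (if t < e / ?L then 0
       else emeasure clocks {\<omega>. At (Suc i, sample (K i x) u) (t - e / ?L) (Suc i + m, y) \<omega> \<and>
              hits (Suc i, sample (K i x) u) (t - e / ?L) l \<omega>}) \<partial>expo \<partial>expo)"
    by (subst emeasure_hits_iter[OF Suc.prems s]) (simp cong: if_cong del: of_nat_Suc)
  also have "\<dots> = (\<integral>\<^sup>+e. \<integral>\<^sup>+u. (if t < e / ?L then 0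
       else ennreal (yule_prob c (Suc i) m (t - e / ?L))) * (ennreal (pmf (steps m (Suc i) (sample (K i x) u)) y) * ?H) \<partial>expo \<partial>expo)"
  proof (intro nn_integral_cong)
    fix e u :: real
    show "(if t < e / ?L then 0
       else emeasure clocks {\<omega>. At (Suc i, sample (K i x) u) (t - e / ?L) (Suc i + m, y) \<omega> \<and>
              hits (Suc i, sample (K i x) u) (t - e / ?L) l \<omega>}) =
      (if t < e / ?L then 0
       else ennreal (yule_prob c (Suc i) m (t - e / ?L))) * (ennreal (pmf (steps m (Suc i) (sample (K i x) u)) y) * ?H)"
      using Suc.IH[of "t - e / ?L" "Suc i" "sample (K i x) u"]
      by (simp add: ennreal_mult yule_prob_nonneg c_pos mult.assoc del: of_nat_Suc)
  qed
  also have "\<dots> = (\<integral>\<^sup>+e. (if t < e / ?L then 0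
       else ennreal (yule_prob c (Suc i) m (t - e / ?L))) * (ennreal (pmf (steps (Suc m) i x) y) * ?H) \<partial>expo)"
  proof (intro nn_integral_cong)
    fix e
    have "(\<lambda>u. ennreal (pmf (steps m (Suc i) (sample (K i x) u)) y)) \<in> borel_measurable expo"
      unfolding measurable_cong_sets[OF sets_expo refl]
      by (rule measurable_compose[OF measurable_sample]) simp
    then have meas: "(\<lambda>u. ennreal (pmf (steps m (Suc i) (sample (K i x) u)) y) * ?H) \<in> borel_measurable expo"
      by (rule borel_measurable_times_ennreal) simp
    have "(\<integral>\<^sup>+u. ennreal (pmf (steps m (Suc i) (sample (K i x) u)) y) * ?H \<partial>expo) =
      ennreal (pmf (steps (Suc m) i x) y) * ?H"
      by (subst nn_integral_sample[where f = "\<lambda>x'. ennreal (pmf (steps m (Suc i) x') y) * ?H"])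
         (simp add: nn_integral_multc ennreal_pmf_bind)
    then show "(\<integral>\<^sup>+u. (if t < e / ?L then 0
       else ennreal (yule_prob c (Suc i) m (t - e / ?L))) * (ennreal (pmf (steps m (Suc i) (sample (K i x) u)) y) * ?H) \<partial>expo) =
      (if t < e / ?L then 0
       else ennreal (yule_prob c (Suc i) m (t - e / ?L))) * (ennreal (pmf (steps (Suc m) i x) y) * ?H)"
      by (subst nn_integral_cmult[OF meas]) (simp only:)
  qed
  also have "\<dots> = ennreal (yule_prob c i (Suc m) t) * (ennreal (pmf (steps (Suc m) i x) y) * ?H)"
  proof (subst nn_integral_multc)
    show "(\<lambda>e. if t < e / ?L then 0 else ennreal (yule_prob c (Suc i) m (t - e / ?L))) \<in> borel_measurable expo"
      unfolding measurable_cong_sets[OF sets_expo refl] by measurable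
  qed (simp only: yule_prob_iter[OF c_pos Suc.prems])
  finally show ?case
    by (simp add: ennreal_mult yule_prob_nonneg c_pos Suc.prems mult.assoc del: steps.simps)
qed

definition pair_kernel :: "real \<Rightarrow> nat \<times> 's \<Rightarrow> (nat \<times> 's) pmf" where
  "pair_kernel t z = bind_pmf (neg_binomial_pmf (Suc (fst z)) (exp (- (c * t))))
     (\<lambda>m. map_pmf (Pair (fst z + m)) (steps m (fst z) (snd z)))"

lemma pmf_pair_kernel:
  assumes "0 \<le> t"
  shows "pmf (pair_kernel t (i, x)) (j, y) = (if i \<le> j then yule_prob c i (j - i) t * pmf (steps (j - i) i x) y else 0)"
proof -
  have *: "pmf (map_pmf (Pair (i + m)) (steps m i x)) (j, y) = (if j = i + m then pmf (steps m i x) y else 0)" for m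
  proof (cases "j = i + m")
    case True
    then show ?thesis using pmf_map_inj'[of "Pair (i + m)" "steps m i x" y] by (simp add: inj_on_def)
  next
    case False
    then show ?thesis by (auto intro!: pmf_eq_0_set_pmf[THEN iffD2])
  qed
  have "pmf (pair_kernel t (i, x)) (j, y) =
    measure_pmf.expectation (neg_binomial_pmf (Suc i) (exp (- (c * t)))) (\<lambda>m. if j = i + m then pmf (steps m i x) y else 0)"
    unfolding pair_kernel_def by (simp add: pmf_bind *)
  also have "\<dots> = (\<Sum>m\<in>{j - i}. (if j = i + m then pmf (steps m i x) y else 0) * pmf (neg_binomial_pmf (Suc i) (exp (- (c * t)))) m)"
    by (rule integral_measure_pmf_real) (auto split: if_splits)
  finally show ?thesis using pmf_yule[OF c_pos assms, of i "j - i"] by (auto simp: mult.commute)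
qed

lemma renewal_pair:
  assumes "0 \<le> t" and s: "\<forall>(s, w)\<in>set l. 0 \<le> s"
  shows "emeasure clocks {\<omega>. At z t w \<omega> \<and> hits z t l \<omega>} =
    ennreal (pmf (pair_kernel t z) w) * emeasure clocks {\<omega>. hits w 0 l \<omega>}"
proof -
  obtain i x j y where [simp]: "z = (i, x)" "w = (j, y)" by fastforce
  show ?thesis
  proof (cases "i \<le> j")
    case True
    then show ?thesis
      using renewal[OF assms, of i x "j - i" y] by (simp add: pmf_pair_kernel[OF assms(1)])
  next
    case False
    then have "\<not> At z t w \<omega>" for \<omega> by (auto simp: At_def)
    then show ?thesis using False by (simp add: pmf_pair_kernel[OF assms(1)])
  qed
qed

lemma emeasure_At: "0 \<le> t \<Longrightarrow> emeasure clocks {\<omega>. At z t w \<omega>} = ennreal (pmf (pair_kernel t z) w)"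
  using renewal_pair[of t "[]" z w] clocks.emeasure_space_1 by (simp add: hits_def)

end

section \<open>Paths and their finite-dimensional distributions\<close>

text \<open>
  Observation times are described by their successive differences, the form in which
  a semigroup acts.
\<close>

fun partial_sums :: "real \<Rightarrow> real list \<Rightarrow> real list" where
  "partial_sums t [] = []"
| "partial_sums t (d # ds) = (t + d) # partial_sums (t + d) ds"

lemma length_partial_sums [simp]: "length (partial_sums t ds) = length ds"
  by (induction ds arbitrary: t) auto

lemma partial_sums_shift: "partial_sums (t + d) ds = map ((+) d) (partial_sums t ds)"
proof (induction ds arbitrary: t)
  case (Cons a ds)
  have "t + d + a = t + a + d" by simp
  then show ?case by (simp only: partial_sums.simps list.map Cons.IH) simp
qed simp

lemma partial_sums_ge: "\<forall>d\<in>set ds. 0 \<le> d \<Longrightarrow> s \<in> set (partial_sums t ds) \<Longrightarrow> t \<le> s"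
  by (induction ds arbitrary: t) fastforce+

lemma map_eq_iff_zip:
  "length xs = length ys \<Longrightarrow> (\<forall>(x, y)\<in>set (zip xs ys). f x = y) \<longleftrightarrow> map f xs = ys"
  by (induction xs ys rule: list_induct2) auto

lemma measurable_map_list:
  fixes Y :: "'i \<Rightarrow> 'w \<Rightarrow> 'a::countable"
  assumes "\<forall>s\<in>set ss. Y s \<in> measurable M (count_space UNIV)"
  shows "(\<lambda>\<omega>. map (\<lambda>s. Y s \<omega>) ss) \<in> measurable M (count_space UNIV)"
  using assms
proof (induction ss)
  case (Cons s ss)
  then have [measurable]: "Y s \<in> measurable M (count_space UNIV)"
    "(\<lambda>\<omega>. map (\<lambda>s. Y s \<omega>) ss) \<in> measurable M (count_space UNIV)"
    by auto
  show ?case by simp measurable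
qed simp

text \<open>
  The law of the observations of a Markov process started at \<open>x\<close>. Recursion from the front lets
  lumping and intertwining be proved by a plain induction on the list of time differences.
\<close>

primrec path_law :: "(real \<Rightarrow> 'a \<Rightarrow> 'a pmf) \<Rightarrow> 'a \<Rightarrow> real list \<Rightarrow> 'a list pmf" where
  "path_law P x [] = return_pmf []"
| "path_law P x (d # ds) = bind_pmf (P d x) (\<lambda>y. map_pmf ((#) y) (path_law P y ds))"

lemma pmf_path_law_Cons:
  "pmf (path_law P x (d # ds)) (y # ys) = pmf (P d x) y * pmf (path_law P y ds) ys"
proof -
  have "pmf (map_pmf ((#) z) (path_law P z ds)) (y # ys) = (if z = y then pmf (path_law P y ds) ys else 0)" for z
  proof (cases "z = y")
    case True
    then show ?thesis using pmf_map_inj'[of "(#) z" "path_law P z ds" ys] by (simp add: inj_on_def)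
  next
    case False
    then show ?thesis by (auto intro!: pmf_eq_0_set_pmf[THEN iffD2])
  qed
  then have "pmf (path_law P x (d # ds)) (y # ys) =
    measure_pmf.expectation (P d x) (\<lambda>z. if z = y then pmf (path_law P y ds) ys else 0)"
    by (simp add: pmf_bind)
  also have "\<dots> = (\<Sum>z\<in>{y}. (if z = y then pmf (path_law P y ds) ys else 0) * pmf (P d x) z)"
    by (rule integral_measure_pmf_real) (auto split: if_splits)
  finally show ?thesis by simp
qed

lemma length_path_law: "ys \<in> set_pmf (path_law P x ds) \<Longrightarrow> length ys = length ds"
  by (induction ds arbitrary: x ys) auto

lemma pmf_path_law_snoc:
  "length ys = length ds \<Longrightarrow>
   pmf (path_law P x (ds @ [d])) (ys @ [y]) = pmf (path_law P x ds) ys * pmf (P d (last (x # ys))) y"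
proof (induction ys ds arbitrary: x rule: list_induct2)
  case Nil
  have "pmf (path_law P x [d]) [y] = pmf (P d x) y"
    unfolding pmf_path_law_Cons by simp
  then show ?case by simp
next
  case (Cons z zs e es)
  then show ?case by (simp only: append_Cons pmf_path_law_Cons) simp
qed

context yule_chain
begin

lemma At_exists:
  assumes "\<forall>l. 0 < \<omega> l" "0 \<le> t" "t < jump_time i m \<omega>"
  shows "\<exists>w. At (i, x) t w \<omega>"
proof -
  define n where "n = (LEAST n. t < jump_time i n \<omega>)"
  have n: "t < jump_time i n \<omega>" unfolding n_def by (rule LeastI) fact
  then obtain k where k: "n = Suc k" using assms(2) by (cases n) auto
  have "\<not> t < jump_time i k \<omega>" using not_less_Least[of k "\<lambda>n. t < jump_time i n \<omega>"] k n_def by simp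
  then have "At (i, x) t (i + k, skeleton i x k \<omega>) \<omega>" using n k by (auto simp: At_def)
  then show ?thesis ..
qed

text \<open>
  Non-explosion: the probabilities of the possible values at time \<open>t\<close> form a probability mass
  function, so they add up to one and leave no room for an explosion.
\<close>

lemma AE_At_exists:
  assumes "0 \<le> t" shows "AE \<omega> in clocks. \<exists>w. At z t w \<omega>"
proof -
  let ?A = "\<lambda>w. {\<omega>. At z t w \<omega> \<and> (\<forall>l. 0 < \<omega> l)}"
  have m: "?A w \<in> sets clocks" for w
  proof -
    have "Measurable.pred clocks (\<lambda>\<omega>. At z t w \<omega> \<and> (\<forall>l. 0 < \<omega> l))" by measurable
    then show ?thesis by (simp add: pred_def)
  qed
  have "emeasure clocks (\<Union>w\<in>UNIV. ?A w) = (\<integral>\<^sup>+w. emeasure clocks (?A w) \<partial>count_space UNIV)"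
    by (rule emeasure_UN_countable) (use m in \<open>auto simp: disjoint_family_on_def dest: At_unique\<close>)
  also have "\<dots> = (\<integral>\<^sup>+w. ennreal (pmf (pair_kernel t z) w) \<partial>count_space UNIV)"
  proof (intro nn_integral_cong)
    fix w
    have "emeasure clocks (?A w) = emeasure clocks {\<omega>. At z t w \<omega>}"
      by (rule emeasure_clocks_AE_cong) auto
    then show "emeasure clocks (?A w) = ennreal (pmf (pair_kernel t z) w)"
      using emeasure_At[OF assms] by simp
  qed
  also have "\<dots> = 1" by (simp add: nn_integral_pmf)
  finally have "AE \<omega> in clocks. \<omega> \<in> (\<Union>w\<in>UNIV. ?A w)"
    using m by (subst clocks.AE_in_set_eq_1) (auto simp: measure_def)
  then show ?thesis by eventually_elim auto
qed

text \<open>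
  Integer times suffice: a path that has not exploded by time \<open>n\<close> has a value at all earlier times.
\<close>

definition good :: "nat \<times> 's \<Rightarrow> outcome set" where
  "good z = {\<omega>. (\<forall>l. 0 < \<omega> l) \<and> (\<forall>n::nat. \<exists>w. At z (real n) w \<omega>)}"

text \<open>
  On the null set of exceptional paths the value is constant, so that all paths are right-continuous
  and start at \<open>z\<close>.
\<close>

definition process :: "nat \<times> 's \<Rightarrow> real \<Rightarrow> outcome \<Rightarrow> nat \<times> 's" where
  "process z t \<omega> = (if \<omega> \<in> good z then THE w. At z t w \<omega> else z)"

lemma AE_good: "AE \<omega> in clocks. \<omega> \<in> good z"
  using AE_clocks_pos AE_At_exists[of "real _" z]
  unfolding good_def by (auto simp: AE_all_countable)

lemma process_At:
  assumes "\<omega> \<in> good z" "0 \<le> t"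
  shows "process z t \<omega> = w \<longleftrightarrow> At z t w \<omega>"
proof -
  obtain i x where z: "z = (i, x)" by fastforce
  obtain n :: nat where n: "t \<le> real n" using real_arch_simple by blast
  obtain w' where "At z (real n) w' \<omega>" using assms unfolding good_def by blast
  then have "t < jump_time i (Suc (fst w' - i)) \<omega>" using n z by (auto simp: At_def)
  with assms have "\<exists>w. At z t w \<omega>" unfolding z good_def by (intro At_exists) auto
  then obtain w' where w': "At z t w' \<omega>" by blast
  have unique: "\<And>w w'. At z t w \<omega> \<Longrightarrow> At z t w' \<omega> \<Longrightarrow> w = w'"
    using assms At_unique unfolding good_def by blast
  have "(THE w. At z t w \<omega>) = w'"
    by (rule the_equality[of "\<lambda>w. At z t w \<omega>", OF w']) (rule unique[OF _ w'])
  then have "process z t \<omega> = w'" using assms(1) by (simp add: process_def)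
  then show ?thesis using unique[OF w'] w' by blast
qed

lemma sets_good [measurable]: "good z \<in> sets clocks"
proof -
  have "Measurable.pred clocks (\<lambda>\<omega>. (\<forall>l. 0 < \<omega> l) \<and> (\<forall>n::nat. \<exists>w. At z (real n) w \<omega>))" by measurable
  then show ?thesis by (simp add: pred_def good_def)
qed

lemma measurable_process:
  assumes "0 \<le> t" shows "process z t \<in> measurable clocks (count_space UNIV)"
proof (subst measurable_count_space_eq2_countable, intro conjI ballI)
  fix w
  have "{\<omega>. At z t w \<omega>} \<in> sets clocks" using sets_hits(1)[of z t w "[]"] by (simp add: hits_def)
  then have "(good z \<inter> {\<omega>. At z t w \<omega>}) \<union> (if w = z then - good z else {}) \<in> sets clocks"
    using sets.compl_sets[OF sets_good[of z]] by (auto simp: Compl_eq_Diff_UNIV)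
  also have "(good z \<inter> {\<omega>. At z t w \<omega>}) \<union> (if w = z then - good z else {}) = process z t -` {w} \<inter> space clocks"
  proof (intro set_eqI)
    fix \<omega>
    show "\<omega> \<in> (good z \<inter> {\<omega>. At z t w \<omega>}) \<union> (if w = z then - good z else {}) \<longleftrightarrow>
      \<omega> \<in> process z t -` {w} \<inter> space clocks"
    proof (cases "\<omega> \<in> good z")
      case True
      then show ?thesis using process_At[OF True assms, of w] by simp
    qed (auto simp: process_def)
  qed
  finally show "process z t -` {w} \<inter> space clocks \<in> sets clocks" .
qed auto

lemma process_0: "process z 0 \<omega> = z"
proof (cases "\<omega> \<in> good z")
  case True
  then have "At z 0 z \<omega>" using c_pos by (auto simp: At_def good_def jump_time_def)
  then show ?thesis using process_At[OF True] by simp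
qed (simp add: process_def)

lemma process_right_continuous:
  assumes "0 \<le> t" shows "\<forall>\<^sub>F s in at_right t. process z s \<omega> = process z t \<omega>"
proof (cases "\<omega> \<in> good z")
  case True
  let ?w = "process z t \<omega>"
  have w: "At z t ?w \<omega>" using process_At[OF True assms] by blast
  have "process z s \<omega> = ?w" if "t < s" "s < jump_time (fst z) (Suc (fst ?w - fst z)) \<omega>" for s
    using that w assms by (subst process_At[OF True]) (auto simp: At_def)
  moreover have "t < jump_time (fst z) (Suc (fst ?w - fst z)) \<omega>" using w by (auto simp: At_def)
  ultimately show ?thesis by (auto simp: eventually_at_right)
qed (simp add: process_def)

lemma emeasure_hits:
  assumes "length ws = length ds" "\<forall>d\<in>set ds. 0 \<le> d"
  shows "emeasure clocks {\<omega>. hits z 0 (zip (partial_sums 0 ds) ws) \<omega>} = ennreal (pmf (path_law pair_kernel z ds) ws)"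
  using assms
proof (induction ws ds arbitrary: z rule: list_induct2)
  case Nil
  then show ?case using clocks.emeasure_space_1 by (simp add: hits_def)
next
  case (Cons w ws d ds)
  have "{\<omega>. hits z 0 (zip (partial_sums 0 (d # ds)) (w # ws)) \<omega>} =
    {\<omega>. At z d w \<omega> \<and> hits z d (zip (partial_sums 0 ds) ws) \<omega>}"
    using partial_sums_shift[of 0 d ds] by (auto simp: hits_def zip_map1)
  then show ?case
    using Cons by (simp only: pmf_path_law_Cons)
      (subst renewal_pair, auto simp: ennreal_mult dest!: set_zip_leftD intro: partial_sums_ge[of ds _ 0])
qed

lemma measurable_process_list:
  "\<forall>s\<in>set ss. 0 \<le> s \<Longrightarrow> (\<lambda>\<omega>. map (\<lambda>s. process z s \<omega>) ss) \<in> measurable clocks (count_space UNIV)"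
  by (intro measurable_map_list) (auto intro: measurable_process)

theorem distr_process:
  assumes ds: "\<forall>d\<in>set ds. 0 \<le> d"
  shows "distr clocks (count_space UNIV) (\<lambda>\<omega>. map (\<lambda>s. process z s \<omega>) (partial_sums 0 ds)) =
    measure_pmf (path_law pair_kernel z ds)"
proof (rule measure_eqI_countable[where A = UNIV])
  have nonneg: "\<forall>s\<in>set (partial_sums 0 ds). 0 \<le> s" using partial_sums_ge[OF ds] by auto
  fix ws :: "(nat \<times> 's) list"
  have 1: "emeasure (distr clocks (count_space UNIV) (\<lambda>\<omega>. map (\<lambda>s. process z s \<omega>) (partial_sums 0 ds))) {ws} =
    emeasure clocks {\<omega>. map (\<lambda>s. process z s \<omega>) (partial_sums 0 ds) = ws}"
    by (subst emeasure_distr[OF measurable_process_list[OF nonneg]]) (auto simp: vimage_def)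
  show "emeasure (distr clocks (count_space UNIV) (\<lambda>\<omega>. map (\<lambda>s. process z s \<omega>) (partial_sums 0 ds))) {ws} =
    emeasure (measure_pmf (path_law pair_kernel z ds)) {ws}"
  proof (cases "length ws = length ds")
    case False
    then have "{\<omega>. map (\<lambda>s. process z s \<omega>) (partial_sums 0 ds) = ws} = {}"
      by (auto dest!: arg_cong[where f = length])
    moreover have "pmf (path_law pair_kernel z ds) ws = 0"
      using False length_path_law[of ws pair_kernel z ds] by (auto intro!: pmf_eq_0_set_pmf[THEN iffD2])
    ultimately show ?thesis unfolding 1 by (simp add: emeasure_pmf_single)
  next
    case True
    have "emeasure clocks {\<omega>. map (\<lambda>s. process z s \<omega>) (partial_sums 0 ds) = ws} =
      emeasure clocks {\<omega>. hits z 0 (zip (partial_sums 0 ds) ws) \<omega>}"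
    proof (rule emeasure_eq_AE)
      show "AE \<omega> in clocks. (\<omega> \<in> {\<omega>. map (\<lambda>s. process z s \<omega>) (partial_sums 0 ds) = ws}) =
         (\<omega> \<in> {\<omega>. hits z 0 (zip (partial_sums 0 ds) ws) \<omega>})"
        using AE_good[of z]
      proof eventually_elim
        fix \<omega> assume "\<omega> \<in> good z"
        then have eq: "process z s \<omega> = w \<longleftrightarrow> At z s w \<omega>" if "s \<in> set (partial_sums 0 ds)" for s w
          using process_At that nonneg by auto
        show "(\<omega> \<in> {\<omega>. map (\<lambda>s. process z s \<omega>) (partial_sums 0 ds) = ws}) =
         (\<omega> \<in> {\<omega>. hits z 0 (zip (partial_sums 0 ds) ws) \<omega>})"
        proof -
          have "(\<forall>(s, w)\<in>set (zip (partial_sums 0 ds) ws). process z s \<omega> = w) \<longleftrightarrow>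
            map (\<lambda>s. process z s \<omega>) (partial_sums 0 ds) = ws"
            using True by (intro map_eq_iff_zip) simp
          moreover have "(\<forall>(s, w)\<in>set (zip (partial_sums 0 ds) ws). process z s \<omega> = w) \<longleftrightarrow>
            hits z 0 (zip (partial_sums 0 ds) ws) \<omega>"
            unfolding hits_def by (intro ball_cong refl) (use eq in \<open>auto dest: set_zip_leftD\<close>)
          ultimately show ?thesis by simp
        qed
      qed
      show "{\<omega>. map (\<lambda>s. process z s \<omega>) (partial_sums 0 ds) = ws} \<in> sets clocks"
        using measurable_sets[OF measurable_process_list[OF nonneg], of "{ws}"] by (simp add: vimage_def)
    qed simp
    then show ?thesis unfolding 1 using emeasure_hits[OF True ds] by (simp add: emeasure_pmf_single)
  qed
qed auto

text \<open>
  Observing the process at \<open>s + t\<close> alone, or at \<open>s\<close> and \<open>s + t\<close> and then ignoring the first value, gives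
  the same law.
\<close>

lemma pair_kernel_semigroup:
  assumes "0 \<le> s" "0 \<le> t"
  shows "pair_kernel (s + t) z = bind_pmf (pair_kernel s z) (pair_kernel t)"
proof -
  have last: "map_pmf last (path_law pair_kernel z [s + t]) = map_pmf last (path_law pair_kernel z [s, t])"
  proof -
    have "measure_pmf (map_pmf last (path_law pair_kernel z ds)) =
      distr clocks (count_space UNIV) (\<lambda>\<omega>. process z (last (partial_sums 0 ds)) \<omega>)"
      if ds: "\<forall>d\<in>set ds. 0 \<le> d" "ds \<noteq> []" for ds
    proof -
      have "(\<lambda>\<omega>. map (\<lambda>s. process z s \<omega>) (partial_sums 0 ds)) \<in> measurable clocks (count_space UNIV)"
        using partial_sums_ge[OF ds(1)] by (intro measurable_process_list) auto
      moreover have "partial_sums 0 ds \<noteq> []" using ds by (cases ds) auto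
      ultimately show ?thesis
        by (simp add: map_pmf_rep_eq distr_process[OF ds(1), symmetric] distr_distr comp_def last_map)
    qed
    from this[of "[s + t]"] this[of "[s, t]"] show ?thesis
      using assms by (simp add: measure_pmf_inject[symmetric])
  qed
  then show ?thesis
    by (simp add: map_bind_pmf map_pmf_comp bind_return_pmf' map_pmf_def[symmetric] bind_map_pmf)
qed

end

section \<open>Chains given by lists of events\<close>

text \<open>
  An event is a rate together with the law of its target, and different events may share
  targets or leave the state unchanged. Of the events and the remaining rate up to \<open>r\<close>, which stands for
  doing nothing, one is selected with probability proportional to its rate.
\<close>

primrec mix :: "(real \<times> 's pmf) list \<Rightarrow> real \<Rightarrow> 's \<Rightarrow> 's pmf" where
  "mix [] r x = return_pmf x"
| "mix (e # es) r x = bind_pmf (bernoulli_pmf (fst e / r)) (\<lambda>b. if b then snd e else mix es (r - fst e) x)"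

text \<open>
  The generator of the events applied to a function.
\<close>

definition flow :: "(real \<times> 's pmf) list \<Rightarrow> ('s \<Rightarrow> real) \<Rightarrow> 's \<Rightarrow> real" where
  "flow es f x = (\<Sum>(a, D)\<leftarrow>es. a * (measure_pmf.expectation D f - f x))"

lemma flow_Nil [simp]: "flow [] f x = 0"
  and flow_Cons: "flow (e # es) f x = fst e * (measure_pmf.expectation (snd e) f - f x) + flow es f x"
  by (simp_all add: flow_def case_prod_beta)

lemma set_mix:
  "set_pmf (mix es r x) \<subseteq> insert x (\<Union>e\<in>{e \<in> set es. fst e \<noteq> 0}. set_pmf (snd e))"
proof (induction es arbitrary: r)
  case (Cons e es)
  have "fst e \<noteq> 0" if "True \<in> set_pmf (bernoulli_pmf (fst e / r))"
  proof
    assume "fst e = 0"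
    then have "pmf (bernoulli_pmf (fst e / r)) True = 0" by simp
    then show False using that by (simp add: set_pmf_iff)
  qed
  then have "set_pmf (mix (e # es) r x) \<subseteq> (if fst e \<noteq> 0 then set_pmf (snd e) else {}) \<union> set_pmf (mix es (r - fst e) x)"
    by (auto split: if_splits)
  also have "\<dots> \<subseteq> (if fst e \<noteq> 0 then set_pmf (snd e) else {}) \<union> insert x (\<Union>e\<in>{e \<in> set es. fst e \<noteq> 0}. set_pmf (snd e))"
    using Cons.IH[of "r - fst e"] by blast
  also have "\<dots> \<subseteq> insert x (\<Union>e\<in>{e' \<in> set (e # es). fst e' \<noteq> 0}. set_pmf (snd e))"
    by auto
  finally show ?case .
qed simp

lemma finite_set_mix:
  "\<forall>e\<in>set es. finite (set_pmf (snd e)) \<Longrightarrow> finite (set_pmf (mix es r x))"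
  by (rule finite_subset[OF set_mix]) auto

lemma expectation_mix:
  assumes "\<forall>e\<in>set es. 0 \<le> fst e \<and> finite (set_pmf (snd e))" and "sum_list (map fst es) \<le> r"
  shows "r * measure_pmf.expectation (mix es r x) f = r * f x + flow es f x"
  using assms
proof (induction es arbitrary: r)
  case (Cons e es)
  have nonneg: "0 \<le> sum_list (map fst es)" using Cons.prems(1) by (intro sum_list_nonneg) auto
  have le: "fst e \<le> r" "0 \<le> fst e" using Cons.prems nonneg by auto
  then have q: "0 \<le> fst e / r" "fst e / r \<le> 1" by (auto simp: divide_le_eq_1)
  have "measure_pmf.expectation (mix (e # es) r x) f =
    (\<Sum>b\<in>UNIV. pmf (bernoulli_pmf (fst e / r)) b *\<^sub>R measure_pmf.expectation (if b then snd e else mix es (r - fst e) x) f)"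
    unfolding mix.simps
    by (rule pmf_expectation_bind) (use Cons.prems(1) in \<open>auto intro: finite_set_mix\<close>)
  also have "\<dots> = (fst e / r) * measure_pmf.expectation (snd e) f + (1 - fst e / r) * measure_pmf.expectation (mix es (r - fst e) x) f"
    using q by (simp add: UNIV_bool)
  finally have eq: "measure_pmf.expectation (mix (e # es) r x) f = \<dots>" .
  show ?case
  proof (cases "r = 0")
    case True
    then have "fst e = 0" using le by simp
    then show ?thesis using Cons.IH[of 0] Cons.prems True by (simp add: flow_Cons)
  next
    case False
    then have "r * measure_pmf.expectation (mix (e # es) r x) f =
      fst e * measure_pmf.expectation (snd e) f + (r - fst e) * measure_pmf.expectation (mix es (r - fst e) x) f"
      unfolding eq by (simp add: field_simps)
    also have "(r - fst e) * measure_pmf.expectation (mix es (r - fst e) x) f = (r - fst e) * f x + flow es f x"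
      using Cons.prems by (intro Cons.IH) auto
    finally show ?thesis by (simp add: flow_Cons algebra_simps)
  qed
qed simp

lemma flow_0 [simp]: "flow es (\<lambda>z. 0) x = 0"
  by (induction es) (auto simp: flow_Cons)

lemma flow_cong:
  assumes "f x = g x" "\<And>e z. e \<in> set es \<Longrightarrow> fst e \<noteq> 0 \<Longrightarrow> z \<in> set_pmf (snd e) \<Longrightarrow> f z = g z"
  shows "flow es f x = flow es g x"
proof -
  have "measure_pmf.expectation (snd e) f = measure_pmf.expectation (snd e) g" if "e \<in> set es" "fst e \<noteq> 0" for e
    using assms(2)[OF that] by (intro integral_cong_AE) (auto simp: AE_measure_pmf_iff)
  then have "fst e * (measure_pmf.expectation (snd e) f - f x) = fst e * (measure_pmf.expectation (snd e) g - g x)"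
    if "e \<in> set es" for e
    using that assms(1) by (cases "fst e = 0") auto
  then show ?thesis
    unfolding flow_def case_prod_unfold by (metis (no_types, lifting) map_cong)
qed

lemma flow_add:
  assumes "\<forall>e\<in>set es. finite (set_pmf (snd e))"
  shows "flow es (\<lambda>z. f z + g z) x = flow es f x + flow es g x"
  using assms
  by (induction es) (auto simp: flow_Cons integrable_measure_pmf_finite algebra_simps)

lemma flow_cmult: "flow es (\<lambda>z. k * f z) x = k * flow es f x"
  by (induction es) (auto simp: flow_Cons algebra_simps)

lemma pmf_bind_nat_sums: "(\<lambda>m. pmf p m * pmf (f m) y) sums pmf (bind_pmf p f) y" for p :: "nat pmf"
proof -
  have "ennreal (pmf (bind_pmf p f) y) = (\<Sum>m. ennreal (pmf p m * pmf (f m) y))"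
    unfolding ennreal_pmf_bind
    by (simp add: nn_integral_measure_pmf nn_integral_count_space_nat ennreal_mult)
  then have "(\<lambda>m. ennreal (pmf p m * pmf (f m) y)) sums ennreal (pmf (bind_pmf p f) y)"
    by (simp add: sums_iff)
  then show ?thesis by (subst (asm) sums_ennreal) auto
qed

text \<open>
  The level rises by at most one per jump, so that after \<open>m\<close> jumps it exceeds its initial value by at most
  \<open>m\<close> and the linear bound on the total rate keeps it below the rate of the clock.
\<close>

locale rate_chain =
  fixes c :: real and level :: "'s::countable \<Rightarrow> nat" and ev :: "'s \<Rightarrow> (real \<times> 's pmf) list"
  assumes c_pos: "0 < c"
    and rate_nonneg: "e \<in> set (ev x) \<Longrightarrow> 0 \<le> fst e"
    and finite_targets: "e \<in> set (ev x) \<Longrightarrow> finite (set_pmf (snd e))"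
    and total_rate: "sum_list (map fst (ev x)) \<le> c * real (Suc (level x))"
    and level_step: "e \<in> set (ev x) \<Longrightarrow> fst e \<noteq> 0 \<Longrightarrow> z \<in> set_pmf (snd e) \<Longrightarrow> level z \<le> Suc (level x)"
begin

definition kern :: "nat \<Rightarrow> 's \<Rightarrow> 's pmf" where
  "kern i x = mix (ev x) (c * real (Suc i)) x"

sublocale yule_chain c kern by unfold_locales (rule c_pos)

lemma total_rate_le: "level x \<le> i \<Longrightarrow> sum_list (map fst (ev x)) \<le> c * real (Suc i)"
  using total_rate[of x] c_pos by (rule_tac order_trans) auto

text \<open>
  At an index that is at least the level, the kernel is the identity plus the generator divided by the
  rate \<open>c * (i + 1)\<close> of the clock.
\<close>

lemma expectation_kern:
  assumes "level x \<le> i"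
  shows "c * real (Suc i) * measure_pmf.expectation (kern i x) f = c * real (Suc i) * f x + flow (ev x) f x"
  unfolding kern_def using total_rate_le[OF assms] rate_nonneg finite_targets
  by (intro expectation_mix) auto

lemma level_kern: "z \<in> set_pmf (kern i x) \<Longrightarrow> level z \<le> Suc (level x)"
  using set_mix[of "ev x" "c * real (Suc i)" x] level_step[of _ x z] unfolding kern_def by auto

lemma level_steps: "y \<in> set_pmf (steps m i x) \<Longrightarrow> level y \<le> level x + m"
  by (induction m arbitrary: i x) (auto dest!: level_kern, fastforce)

lemma level_pair_kernel:
  "level x \<le> i \<Longrightarrow> (j, y) \<in> set_pmf (pair_kernel t (i, x)) \<Longrightarrow> level y \<le> j"
  by (auto simp: pair_kernel_def dest!: level_steps)

text \<open>
  The coefficients of the power series in \<open>1 - exp (- c * t)\<close> for the law of the state at time \<open>t\<close>, up to a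
  common factor. With \<open>A\<close> the generator divided by \<open>c\<close>, they are those of the rising
  factorial \<open>(i + 1 + A) \<cdots> (i + m + A) / m!\<close>, so with the factor \<open>exp (- c * (i + 1) * t)\<close> the series sums
  to \<open>exp (c * t * A)\<close> whatever the value of \<open>i\<close>. The recurrences below replace this formal computation.
\<close>

definition weight :: "nat \<Rightarrow> nat \<Rightarrow> 's \<Rightarrow> 's \<Rightarrow> real" where
  "weight i m y x = real (i + m choose m) * pmf (steps m i x) y"

lemma weight_0: "weight i 0 y x = indicator {y} x"
  by (simp add: weight_def pmf_return indicator_def)

lemma weight_Suc:
  assumes "level x \<le> i"
  shows "real (Suc m) * weight i (Suc m) y x =
    real (Suc i) * weight (Suc i) m y x + flow (ev x) (weight (Suc i) m y) x / c"
proof -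
  let ?f = "\<lambda>z. pmf (steps m (Suc i) z) y"
  have "c * (real (Suc m) * weight i (Suc m) y x) =
    c * (real (i + Suc m choose Suc m) * real (Suc m)) * pmf (steps (Suc m) i x) y"
    unfolding weight_def by (simp only: mult_ac)
  also have "\<dots> = real (Suc i + m choose m) * (c * real (Suc i) * pmf (steps (Suc m) i x) y)"
    unfolding choose_Suc_shift by (simp only: mult_ac)
  also have "c * real (Suc i) * pmf (steps (Suc m) i x) y = c * real (Suc i) * ?f x + flow (ev x) ?f x"
    unfolding steps.simps pmf_bind by (rule expectation_kern[OF assms])
  finally have "c * (real (Suc m) * weight i (Suc m) y x) = c * (real (Suc i) * weight (Suc i) m y x) + flow (ev x) (weight (Suc i) m y) x"
    unfolding weight_def[abs_def] flow_cmult by (simp only: distrib_left mult_ac)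
  then have "real (Suc m) * weight i (Suc m) y x =
    (c * (real (Suc i) * weight (Suc i) m y x) + flow (ev x) (weight (Suc i) m y) x) / c"
    using c_pos by (metis less_irrefl nonzero_mult_div_cancel_left)
  then show ?thesis using c_pos by (simp only: add_divide_distrib) simp
qed

text \<open>
  The Pascal rule for rising factorials. The induction moves one step along the chain, which raises
  the level and the index together, so the hypothesis stays available.
\<close>

lemma weight_recurrence:
  assumes "level x \<le> i"
  shows "weight (Suc i) m y x = weight i m y x + (case m of 0 \<Rightarrow> 0 | Suc k \<Rightarrow> weight (Suc i) k y x)"
  using assms
proof (induction m arbitrary: i x)
  case 0
  then show ?case by (simp add: weight_0)
next
  case (Suc m)
  let ?G = "\<lambda>z. case m of 0 \<Rightarrow> 0 | Suc k \<Rightarrow> weight (Suc (Suc i)) k y z"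
  have eq: "weight (Suc (Suc i)) m y z = weight (Suc i) m y z + ?G z" if "level z \<le> Suc i" for z
    by (rule Suc.IH[OF that])
  have "flow (ev x) (weight (Suc (Suc i)) m y) x = flow (ev x) (\<lambda>z. weight (Suc i) m y z + ?G z) x"
    using Suc.prems by (intro flow_cong eq) (auto dest!: level_step)
  also have "\<dots> = flow (ev x) (weight (Suc i) m y) x + flow (ev x) ?G x"
    using finite_targets by (intro flow_add) auto
  finally have flow_eq: "flow (ev x) (weight (Suc (Suc i)) m y) x = \<dots>" .
  have G: "real (Suc (Suc i)) * ?G x + flow (ev x) ?G x / c = real m * weight (Suc i) m y x"
  proof (cases m)
    case (Suc k)
    then show ?thesis using weight_Suc[of x "Suc i" k y] Suc.prems by simp
  qed simp
  have "real (Suc m) * weight (Suc i) (Suc m) y x =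
    real (Suc (Suc i)) * (weight (Suc i) m y x + ?G x) + (flow (ev x) (weight (Suc i) m y) x + flow (ev x) ?G x) / c"
    using Suc.prems by (simp only: weight_Suc[of x "Suc i"] le_SucI flow_eq eq)
  also have "\<dots> = real (Suc m) * weight i (Suc m) y x + real (Suc m) * weight (Suc i) m y x"
    unfolding weight_Suc[OF Suc.prems] using G by (simp add: algebra_simps add_divide_distrib)
  finally show ?case by (simp add: distrib_left[symmetric] del: of_nat_Suc)
qed

lemma pair_kernel_snd: "map_pmf snd (pair_kernel t (i, x)) =
    bind_pmf (neg_binomial_pmf (Suc i) (exp (- (c * t)))) (\<lambda>m. steps m i x)"
  by (simp add: pair_kernel_def map_bind_pmf map_pmf_comp)

lemma weight_sums:
  assumes "0 \<le> t"
  shows "(\<lambda>m. exp (- (c * real (Suc i) * t)) * ((1 - exp (- (c * t))) ^ m * weight i m y x)) sums pmf (map_pmf snd (pair_kernel t (i, x))) y"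
  using pmf_bind_nat_sums[of "neg_binomial_pmf (Suc i) (exp (- (c * t)))" "\<lambda>m. steps m i x" y]
  unfolding pmf_yule[OF c_pos assms] pair_kernel_snd by (simp add: yule_prob_def weight_def mult_ac)

text \<open>
  By the recurrence, passing from \<open>i\<close> to \<open>i + 1\<close> divides the power series in \<open>u = 1 - exp (- c * t)\<close> by
  \<open>1 - u = exp (- c * t)\<close>, and the prefactor \<open>exp (- c * (i + 1) * t)\<close> gains this factor.
\<close>

lemma pair_kernel_index_Suc:
  assumes "0 \<le> t" "level x \<le> i"
  shows "map_pmf snd (pair_kernel t (Suc i, x)) = map_pmf snd (pair_kernel t (i, x))"
proof (rule pmf_eqI)
  fix y
  define u where "u = 1 - exp (- (c * t))"
  define S where "S j = (\<Sum>m. u ^ m * weight j m y x)" for j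
  have sums: "(\<lambda>m. u ^ m * weight j m y x) sums S j"
    and S: "exp (- (c * real (Suc j) * t)) * S j = pmf (map_pmf snd (pair_kernel t (j, x))) y" for j
  proof -
    have 1: "(\<lambda>m. exp (- (c * real (Suc j) * t)) * (u ^ m * weight j m y x)) sums pmf (map_pmf snd (pair_kernel t (j, x))) y"
      using weight_sums[OF assms(1), of j y x] unfolding u_def .
    then have "summable (\<lambda>m. u ^ m * weight j m y x)"
      by (subst (asm) sums_iff) (simp add: summable_cmult_iff)
    then show 2: "(\<lambda>m. u ^ m * weight j m y x) sums S j"
      unfolding S_def by (rule summable_sums)
    show "exp (- (c * real (Suc j) * t)) * S j = pmf (map_pmf snd (pair_kernel t (j, x))) y"
      using sums_unique2[OF sums_mult[OF 2] 1] .
  qed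
  have "(\<lambda>m. u * (u ^ m * weight (Suc i) m y x)) sums (u * S (Suc i))"
    by (rule sums_mult[OF sums])
  then have "(\<lambda>m. case m of 0 \<Rightarrow> 0 | Suc k \<Rightarrow> u * (u ^ k * weight (Suc i) k y x)) sums (u * S (Suc i))"
    using sums_Suc_iff[of "\<lambda>m. case m of 0 \<Rightarrow> 0 | Suc k \<Rightarrow> u * (u ^ k * weight (Suc i) k y x)" "u * S (Suc i)"] by simp
  from sums_diff[OF sums[of "Suc i"] this]
  have "(\<lambda>m. u ^ m * weight (Suc i) m y x - (case m of 0 \<Rightarrow> 0 | Suc k \<Rightarrow> u * (u ^ k * weight (Suc i) k y x))) sums (S (Suc i) - u * S (Suc i))" .
  also have "(\<lambda>m. u ^ m * weight (Suc i) m y x - (case m of 0 \<Rightarrow> 0 | Suc k \<Rightarrow> u * (u ^ k * weight (Suc i) k y x))) =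
    (\<lambda>m. u ^ m * weight i m y x)"
    by (rule ext) (subst weight_recurrence[OF assms(2)], simp add: algebra_simps split: nat.split)
  finally have "S i = (1 - u) * S (Suc i)"
    using sums_unique2[OF sums[of i]] by (simp add: algebra_simps)
  then have "exp (- (c * real (Suc i) * t)) * S i = exp (- (c * real (Suc (Suc i)) * t)) * S (Suc i)"
    by (simp add: u_def algebra_simps mult_exp_exp)
  then show "pmf (map_pmf snd (pair_kernel t (Suc i, x))) y = pmf (map_pmf snd (pair_kernel t (i, x))) y"
    unfolding S by simp
qed

text \<open>
  The level is the smallest admissible starting index; every larger one yields the same law.
\<close>

definition transition :: "real \<Rightarrow> 's \<Rightarrow> 's pmf" where
  "transition t x = map_pmf snd (pair_kernel t (level x, x))"

lemma map_snd_pair_kernel: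
  assumes "0 \<le> t" "level x \<le> i"
  shows "map_pmf snd (pair_kernel t (i, x)) = transition t x"
  using assms(2)
proof (induction i rule: dec_induct)
  case (step i)
  then show ?case using pair_kernel_index_Suc[OF assms(1), of x i] by simp
qed (simp add: transition_def)

text \<open>
  Along a path the index never falls below the level, so the index can be forgotten at all
  observation times at once.
\<close>

lemma path_law_transition:
  assumes "\<forall>d\<in>set ds. 0 \<le> d" "level x \<le> i"
  shows "map_pmf (map snd) (path_law pair_kernel (i, x) ds) = path_law transition x ds"
  using assms
proof (induction ds arbitrary: i x)
  case (Cons d ds)
  have "map_pmf (map snd) (path_law pair_kernel (i, x) (d # ds)) =
    bind_pmf (pair_kernel d (i, x)) (\<lambda>z. map_pmf ((#) (snd z)) (map_pmf (map snd) (path_law pair_kernel z ds)))"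
    by (simp add: map_bind_pmf map_pmf_comp)
  also have "\<dots> = bind_pmf (pair_kernel d (i, x)) (\<lambda>z. map_pmf ((#) (snd z)) (path_law transition (snd z) ds))"
  proof (intro bind_pmf_cong refl)
    fix z assume z: "z \<in> set_pmf (pair_kernel d (i, x))"
    obtain j y where "z = (j, y)" by fastforce
    then show "map_pmf ((#) (snd z)) (map_pmf (map snd) (path_law pair_kernel z ds)) =
      map_pmf ((#) (snd z)) (path_law transition (snd z) ds)"
      using Cons level_pair_kernel[of x i j y d] z by simp
  qed
  also have "\<dots> = path_law transition x (d # ds)"
    using Cons.prems map_snd_pair_kernel[of d x i, symmetric] by (simp add: bind_map_pmf)
  finally show ?case .
qed simp

lemma transition_function_transition: "transition_function transition"
  unfolding transition_function_def
proof (intro conjI allI impI)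
  show "transition 0 = return_pmf"
    by (rule ext) (simp add: transition_def pair_kernel_snd bind_return_pmf)
  fix s t :: real and x assume st: "0 \<le> s" "0 \<le> t"
  have "transition (s + t) x = bind_pmf (pair_kernel s (level x, x)) (\<lambda>z. map_pmf snd (pair_kernel t z))"
    unfolding transition_def pair_kernel_semigroup[OF st] by (simp add: map_bind_pmf)
  also have "\<dots> = bind_pmf (pair_kernel s (level x, x)) (\<lambda>z. transition t (snd z))"
    using level_pair_kernel[of x "level x" _ _ s] map_snd_pair_kernel[OF st(2)]
    by (intro bind_pmf_cong refl) (auto simp del: bind_pmf_cong)
  also have "\<dots> = bind_pmf (transition s x) (transition t)"
    by (simp add: transition_def[of s] bind_map_pmf)
  finally show "transition (s + t) x = bind_pmf (transition s x) (transition t)" .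
qed

text \<open>
  Near time zero at most one jump matters: the terms with no jump and with one jump give the
  derivative, and the rest is squeezed by the total probability of two or more jumps, which has
  derivative zero.
\<close>

lemma transition_derivative:
  "((\<lambda>t. pmf (transition t x) y) has_real_derivative flow (ev x) (indicator {y}) x) (at_right 0)"
proof -
  define i where "i = level x"
  define f where "f m = pmf (steps m i x) y" for m
  define p where "p m t = yule_prob c i m t" for m t
  have sums: "(\<lambda>m. p m t * f m) sums pmf (transition t x) y" "(\<lambda>m. p m t) sums 1" if "0 \<le> t" for t
  proof -
    show "(\<lambda>m. p m t * f m) sums pmf (transition t x) y"
      using pmf_bind_nat_sums[of "neg_binomial_pmf (Suc i) (exp (- (c * t)))" "\<lambda>m. steps m i x" y]
      unfolding pmf_yule[OF c_pos that] transition_def pair_kernel_snd i_def[symmetric] p_def f_def .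
    show "(\<lambda>m. p m t) sums 1"
      using pmf_bind_nat_sums[of "neg_binomial_pmf (Suc i) (exp (- (c * t)))" "\<lambda>m. return_pmf ()" "()"]
      unfolding pmf_yule[OF c_pos that] p_def by (simp add: bind_pmf_const)
  qed
  have f01: "0 \<le> f m" "f m \<le> 1" for m by (auto simp: f_def pmf_le_1)
  have p0: "0 \<le> p m t" if "0 \<le> t" for m t using that c_pos by (auto simp: p_def yule_prob_nonneg)
  (* Replacing f m by 0, respectively by 1, for all m >= 2 bounds the probability from both sides. *)
  define lo where "lo t = p 0 t * f 0 + p 1 t * f 1" for t
  define up where "up t = 1 - (p 0 t * (1 - f 0) + p 1 t * (1 - f 1))" for t
  have lo: "lo t \<le> pmf (transition t x) y" if "0 \<le> t" for t
  proof -
    have "sum (\<lambda>m. p m t * f m) {..<2} \<le> (\<Sum>m. p m t * f m)"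
      using sums(1)[OF that] p0[OF that] f01 by (intro sum_le_suminf) (auto simp: sums_iff)
    then show ?thesis using sums(1)[OF that] by (simp add: sums_iff lo_def numeral_2_eq_2)
  qed
  have up: "pmf (transition t x) y \<le> up t" if "0 \<le> t" for t
  proof -
    have *: "(\<lambda>m. p m t * (1 - f m)) sums (1 - pmf (transition t x) y)"
      using sums_diff[OF sums(2)[OF that] sums(1)[OF that]] by (simp add: algebra_simps)
    then have "sum (\<lambda>m. p m t * (1 - f m)) {..<2} \<le> (\<Sum>m. p m t * (1 - f m))"
      using p0[OF that] f01 by (intro sum_le_suminf) (auto simp: sums_iff)
    then show ?thesis using * by (simp add: sums_iff up_def numeral_2_eq_2)
  qed
  let ?D = "- (c * real (Suc i)) * f 0 + c * real (Suc i) * f 1"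
  have d0: "((p 0) has_real_derivative - (c * real (Suc i))) (at_right 0)"
    unfolding p_def yule_prob_def by (auto intro!: derivative_eq_intros simp del: of_nat_Suc)
  have d1: "((p 1) has_real_derivative (c * real (Suc i))) (at_right 0)"
    unfolding p_def yule_prob_def by (auto intro!: derivative_eq_intros simp del: of_nat_Suc)
  have dlo: "(lo has_real_derivative ?D) (at_right 0)"
    unfolding lo_def[abs_def] by (rule derivative_eq_intros d0 d1 refl)+ (simp add: algebra_simps)
  have dup: "(up has_real_derivative ?D) (at_right 0)"
    unfolding up_def[abs_def] by (rule derivative_eq_intros d0 d1 refl)+ (simp add: algebra_simps)
  have at0: "p 0 0 = 1" "p 1 0 = 0" "pmf (transition 0 x) y = f 0"
    using transition_function_transition by (simp_all add: p_def yule_prob_def f_def transition_function_def)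
  have lo0: "lo 0 = f 0" and up0: "up 0 = f 0" unfolding lo_def up_def at0 by simp_all
  have "((\<lambda>t. (pmf (transition t x) y - pmf (transition 0 x) y) / (t - 0)) \<longlongrightarrow> ?D) (at_right 0)"
  proof (rule tendsto_sandwich)
    show "((\<lambda>t. (lo t - lo 0) / (t - 0)) \<longlongrightarrow> ?D) (at_right 0)" "((\<lambda>t. (up t - up 0) / (t - 0)) \<longlongrightarrow> ?D) (at_right 0)"
      using dlo dup by (simp_all add: has_field_derivative_iff)
    have *: "\<forall>\<^sub>F t in at_right 0. (0::real) < t" by (rule eventually_at_right_less)
    show "\<forall>\<^sub>F t in at_right 0. (lo t - lo 0) / (t - 0) \<le> (pmf (transition t x) y - pmf (transition 0 x) y) / (t - 0)"
      using * by eventually_elim (use lo in \<open>auto intro!: divide_right_mono simp: at0 lo0\<close>)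
    show "\<forall>\<^sub>F t in at_right 0. (pmf (transition t x) y - pmf (transition 0 x) y) / (t - 0) \<le> (up t - up 0) / (t - 0)"
      using * by eventually_elim (use up in \<open>auto intro!: divide_right_mono simp: at0 up0\<close>)
  qed
  moreover have "?D = flow (ev x) (indicator {y}) x"
  proof -
    have "steps 0 (Suc i) = return_pmf" by (rule ext) simp
    then have "f 1 = measure_pmf.expectation (kern i x) (indicator {y})"
      unfolding f_def by (simp add: bind_return_pmf' pmf.rep_eq)
    then have "c * real (Suc i) * f 1 = c * real (Suc i) * indicator {y} x + flow (ev x) (indicator {y}) x"
      using expectation_kern[of x i "indicator {y}"] by (simp add: i_def)
    then show ?thesis by (simp add: f_def pmf_return indicator_def)
  qed
  ultimately show ?thesis by (simp add: has_field_derivative_iff)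
qed

end

section \<open>Recognising a chain, lumping and intertwining\<close>

lemma partial_sums_snoc:
  "partial_sums s (ds @ [d]) = partial_sums s ds @ [last (s # partial_sums s ds) + d]"
  by (induction ds arbitrary: s) auto

definition increments :: "(nat \<Rightarrow> real) \<Rightarrow> nat \<Rightarrow> real list" where
  "increments t k = t 0 # map (\<lambda>i. t (Suc i) - t i) [0..<k]"

lemma increments_Suc: "increments t (Suc k) = increments t k @ [t (Suc k) - t k]"
  by (simp add: increments_def)

lemma length_increments [simp]: "length (increments t k) = Suc k"
  by (simp add: increments_def)

lemma partial_sums_increments: "partial_sums 0 (increments t k) = map t [0..<Suc k]"
proof (induction k)
  case 0
  then show ?case by (simp add: increments_def)
next
  case (Suc k)
  have "last (0 # map t [0..<Suc k]) = t k" by simp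
  then show ?case unfolding increments_Suc partial_sums_snoc Suc.IH by simp
qed

context rate_chain
begin

lemma generator_eq_flow:
  assumes q: "\<And>x y. x \<noteq> y \<Longrightarrow> q x y = (\<Sum>(a, D)\<leftarrow>ev x. a * pmf D y)"
  shows "generator q x y = flow (ev x) (indicator {y}) x"
proof (cases "x = y")
  case False
  then show ?thesis
    by (simp add: generator_def q flow_def pmf.rep_eq)
next
  case True
  (* The infinite sum over targets reduces to one over the finitely many states that an event can reach. *)
  define U where "U = (\<Union>e\<in>set (ev x). set_pmf (snd e))"
  have U: "finite U" unfolding U_def using finite_targets by auto
  have mass: "(\<Sum>z\<in>U - {x}. pmf (snd e) z) = 1 - pmf (snd e) x" if "e \<in> set (ev x)" for e
  proof -
    have "(\<Sum>z\<in>insert x U. pmf (snd e) z) = 1"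
      using that U by (intro sum_pmf_eq_1) (auto simp: U_def)
    then show ?thesis using U by (simp add: sum.insert_remove)
  qed
  have zero: "(\<Sum>e\<leftarrow>ev x. fst e * pmf (snd e) z) = 0" if "z \<notin> U" for z
  proof -
    have "map (\<lambda>e. fst e * pmf (snd e) z) (ev x) = map (\<lambda>e. 0) (ev x)"
      using that by (auto simp: U_def pmf_eq_0_set_pmf)
    then show ?thesis by (simp only:) simp
  qed
  have "infsum (q x) (- {x}) = infsum (q x) (U - {x})"
    using q zero by (intro infsum_cong_neutral) (auto simp: case_prod_unfold)
  also have "\<dots> = (\<Sum>z\<in>U - {x}. q x z)" using U by simp
  also have "\<dots> = (\<Sum>z\<in>U - {x}. \<Sum>e\<leftarrow>ev x. fst e * pmf (snd e) z)"
    using q by (intro sum.cong) (auto simp: case_prod_unfold)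
  also have "\<dots> = (\<Sum>e\<leftarrow>ev x. \<Sum>z\<in>U - {x}. fst e * pmf (snd e) z)"
  proof -
    have "(\<Sum>z\<in>V. \<Sum>e\<leftarrow>es. fst e * pmf (snd e) z) = (\<Sum>e\<leftarrow>es. \<Sum>z\<in>V. fst e * pmf (snd e) z)"
      for V and es :: "(real \<times> 's pmf) list"
      by (induction es) (auto simp: sum.distrib)
    then show ?thesis .
  qed
  also have "\<dots> = (\<Sum>e\<leftarrow>ev x. fst e * (1 - pmf (snd e) x))"
    using mass by (intro arg_cong[where f = sum_list] map_cong refl) (simp flip: sum_distrib_left)
  also have "\<dots> = - (\<Sum>e\<leftarrow>ev x. fst e * (pmf (snd e) x - 1))"
    by (subst uminus_sum_list_map) (simp add: comp_def algebra_simps)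
  finally show ?thesis using True
    by (simp add: generator_def flow_def case_prod_unfold pmf.rep_eq)
qed

text \<open>
  Apart from the regularity of the paths, only the finite-dimensional distributions enter, so the
  criterion also applies to functions of a larger chain.
\<close>

theorem is_ctmcI:
  assumes q: "\<And>x y. x \<noteq> y \<Longrightarrow> q x y = (\<Sum>(a, D)\<leftarrow>ev x. a * pmf D y)"
    and meas: "\<And>t. 0 \<le> t \<Longrightarrow> Y t \<in> measurable clocks (count_space UNIV)"
    and rc: "\<And>\<omega> t. 0 \<le> t \<Longrightarrow> \<forall>\<^sub>F s in at_right t. Y s \<omega> = Y t \<omega>"
    and law: "\<And>ds. \<forall>d\<in>set ds. 0 \<le> d \<Longrightarrow>
      distr clocks (count_space UNIV) (\<lambda>\<omega>. map (\<lambda>s. Y s \<omega>) (partial_sums 0 ds)) = measure_pmf (path_law transition y0 ds)"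
  shows "is_ctmc clocks Y q"
proof -
  have fdd: "measure clocks {\<omega> \<in> space clocks. \<forall>i\<le>k. Y (t i) \<omega> = x i} =
      pmf (path_law transition y0 (increments t k)) (map x [0..<Suc k])"
    if t: "0 \<le> t 0" "\<forall>i<k. t i < t (Suc i)" for k t x
  proof -
    have nonneg: "\<forall>d\<in>set (increments t k). 0 \<le> d"
      using t by (auto simp: increments_def intro: less_imp_le)
    have m: "(\<lambda>\<omega>. map (\<lambda>s. Y s \<omega>) (partial_sums 0 (increments t k))) \<in> measurable clocks (count_space UNIV)"
      using partial_sums_ge[OF nonneg] by (intro measurable_map_list) (blast intro: meas)
    have "{\<omega> \<in> space clocks. \<forall>i\<le>k. Y (t i) \<omega> = x i} =
      (\<lambda>\<omega>. map (\<lambda>s. Y s \<omega>) (partial_sums 0 (increments t k))) -` {map x [0..<Suc k]} \<inter> space clocks"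
      unfolding partial_sums_increments by (auto simp: less_Suc_eq_le simp del: upt_Suc)
    also have "measure clocks \<dots> = measure (distr clocks (count_space UNIV) (\<lambda>\<omega>. map (\<lambda>s. Y s \<omega>) (partial_sums 0 (increments t k)))) {map x [0..<Suc k]}"
      by (rule measure_distr[OF m, symmetric]) simp
    also have "\<dots> = pmf (path_law transition y0 (increments t k)) (map x [0..<Suc k])"
      unfolding law[OF nonneg] by (simp add: measure_pmf_single)
    finally show ?thesis .
  qed
  have "markov_with clocks Y transition"
    unfolding markov_with_def
  proof (intro allI impI)
    fix k and t :: "nat \<Rightarrow> real" and x
    assume t: "0 \<le> t 0" "\<forall>i\<le>k. t i < t (Suc i)"
    have "measure clocks {\<omega> \<in> space clocks. \<forall>i\<le>Suc k. Y (t i) \<omega> = x i} =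
      pmf (path_law transition y0 (increments t k @ [t (Suc k) - t k])) (map x [0..<Suc k] @ [x (Suc k)])"
      using t by (subst fdd) (auto simp: increments_Suc)
    also have "\<dots> = pmf (path_law transition y0 (increments t k)) (map x [0..<Suc k]) * pmf (transition (t (Suc k) - t k) (x k)) (x (Suc k))"
      by (subst pmf_path_law_snoc) auto
    finally show "measure clocks {\<omega> \<in> space clocks. \<forall>i\<le>Suc k. Y (t i) \<omega> = x i} =
        measure clocks {\<omega> \<in> space clocks. \<forall>i\<le>k. Y (t i) \<omega> = x i} *
          pmf (transition (t (Suc k) - t k) (x k)) (x (Suc k))"
      using t by (subst (2) fdd) auto
  qed
  moreover have "has_rates transition q"
    unfolding has_rates_def by (simp add: generator_eq_flow[of q, OF q] transition_derivative)
  ultimately show ?thesis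
    unfolding is_ctmc_def using clocks.prob_space_axioms meas rc transition_function_transition by blast
qed

end

text \<open>
  The image of a chain under \<open>\<phi>\<close> is a chain when the generator maps functions of \<open>\<phi>\<close> to functions of
  \<open>\<phi>\<close>. The two chains share the constant \<open>c\<close>, hence the clock, and it suffices to compare the
  discrete kernels.
\<close>

locale strong_lumping =
  X: rate_chain c lx ex + Y: rate_chain c ly ey
  for c :: real and lx :: "'a::countable \<Rightarrow> nat" and ex and ly :: "'b::countable \<Rightarrow> nat" and ey +
  fixes \<phi> :: "'a \<Rightarrow> 'b" and Inv :: "'a \<Rightarrow> bool"
  assumes inv_step: "Inv x \<Longrightarrow> e \<in> set (ex x) \<Longrightarrow> fst e \<noteq> 0 \<Longrightarrow> z \<in> set_pmf (snd e) \<Longrightarrow> Inv z"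
    and level_le: "Inv x \<Longrightarrow> ly (\<phi> x) \<le> lx x"
    and flow_eq: "Inv x \<Longrightarrow> flow (ex x) (\<lambda>z. indicator {y} (\<phi> z)) x = flow (ey (\<phi> x)) (indicator {y}) (\<phi> x)"
begin

lemma map_kern:
  assumes "Inv x" "lx x \<le> i"
  shows "map_pmf \<phi> (X.kern i x) = Y.kern i (\<phi> x)"
proof (rule pmf_eqI)
  fix y
  have c: "c * real (Suc i) \<noteq> 0" using X.c_pos by simp
  have ly: "ly (\<phi> x) \<le> i" using level_le[OF assms(1)] assms(2) by simp
  have "c * real (Suc i) * pmf (map_pmf \<phi> (X.kern i x)) y =
    c * real (Suc i) * measure_pmf.expectation (X.kern i x) (\<lambda>z. indicator {y} (\<phi> z))"
    by (simp add: pmf.rep_eq integral_map_pmf[symmetric] del: of_nat_Suc)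
  also have "\<dots> = c * real (Suc i) * measure_pmf.expectation (Y.kern i (\<phi> x)) (indicator {y})"
    unfolding X.expectation_kern[OF assms(2)] Y.expectation_kern[OF ly] flow_eq[OF assms(1)] ..
  also have "\<dots> = c * real (Suc i) * pmf (Y.kern i (\<phi> x)) y"
    by (simp add: pmf.rep_eq)
  finally show "pmf (map_pmf \<phi> (X.kern i x)) y = pmf (Y.kern i (\<phi> x)) y"
    using c by (simp only: mult_cancel_left) simp
qed

lemma inv_kern: "Inv x \<Longrightarrow> z \<in> set_pmf (X.kern i x) \<Longrightarrow> Inv z"
  using set_mix[of "ex x" "c * real (Suc i)" x] inv_step[of x _ z] unfolding X.kern_def by auto

lemma inv_steps: "Inv x \<Longrightarrow> z \<in> set_pmf (X.steps m i x) \<Longrightarrow> Inv z"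
  by (induction m arbitrary: i x) (auto dest: inv_kern)

lemma map_steps:
  assumes "Inv x" "lx x \<le> i"
  shows "map_pmf \<phi> (X.steps m i x) = Y.steps m i (\<phi> x)"
  using assms
proof (induction m arbitrary: i x)
  case (Suc m)
  have "map_pmf \<phi> (X.steps (Suc m) i x) = bind_pmf (X.kern i x) (\<lambda>z. map_pmf \<phi> (X.steps m (Suc i) z))"
    by (simp add: map_bind_pmf)
  also have "\<dots> = bind_pmf (X.kern i x) (\<lambda>z. Y.steps m (Suc i) (\<phi> z))"
  proof (intro bind_pmf_cong refl Suc.IH)
    fix z assume "z \<in> set_pmf (X.kern i x)"
    then show "Inv z" "lx z \<le> Suc i" using Suc.prems inv_kern X.level_kern[of z i x] by auto
  qed
  also have "\<dots> = Y.steps (Suc m) i (\<phi> x)"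
    using map_kern[OF Suc.prems, symmetric] by (simp add: bind_map_pmf)
  finally show ?case .
qed simp

lemma map_pair_kernel:
  assumes "Inv x" "lx x \<le> i"
  shows "map_pmf (apsnd \<phi>) (X.pair_kernel t (i, x)) = Y.pair_kernel t (i, \<phi> x)"
  unfolding X.pair_kernel_def Y.pair_kernel_def
  by (simp add: map_bind_pmf map_pmf_comp map_steps[OF assms, symmetric])

lemma map_path_law:
  assumes "Inv x" "lx x \<le> i"
  shows "map_pmf (map (apsnd \<phi>)) (path_law X.pair_kernel (i, x) ds) = path_law Y.pair_kernel (i, \<phi> x) ds"
  using assms
proof (induction ds arbitrary: i x)
  case (Cons d ds)
  have "map_pmf (map (apsnd \<phi>)) (path_law X.pair_kernel (i, x) (d # ds)) =
    bind_pmf (X.pair_kernel d (i, x)) (\<lambda>z. map_pmf ((#) (apsnd \<phi> z)) (map_pmf (map (apsnd \<phi>)) (path_law X.pair_kernel z ds)))"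
    by (simp add: map_bind_pmf map_pmf_comp)
  also have "\<dots> = bind_pmf (X.pair_kernel d (i, x)) (\<lambda>z. map_pmf ((#) (apsnd \<phi> z)) (path_law Y.pair_kernel (apsnd \<phi> z) ds))"
  proof (intro bind_pmf_cong refl)
    fix z assume z: "z \<in> set_pmf (X.pair_kernel d (i, x))"
    obtain j y where jy: "z = (j, y)" by fastforce
    have "Inv y" using z jy Cons.prems by (auto simp: X.pair_kernel_def dest: inv_steps)
    moreover have "lx y \<le> j" using X.level_pair_kernel[of x i j y d] Cons.prems z jy by simp
    ultimately show "map_pmf ((#) (apsnd \<phi> z)) (map_pmf (map (apsnd \<phi>)) (path_law X.pair_kernel z ds)) =
      map_pmf ((#) (apsnd \<phi> z)) (path_law Y.pair_kernel (apsnd \<phi> z) ds)"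
      using Cons.IH jy by simp
  qed
  also have "\<dots> = path_law Y.pair_kernel (i, \<phi> x) (d # ds)"
    using map_pair_kernel[OF Cons.prems, of d, symmetric] by (simp add: bind_map_pmf)
  finally show ?case .
qed simp

end

text \<open>
  A weaker situation in which the image of a chain under \<open>g\<close> is still Markov: the kernel \<open>\<Lambda>\<close> recovers the
  conditional law of the hidden state from the visible one, and it commutes with the dynamics event
  by event. If the hidden state has law \<open>\<Lambda> y\<close> at the start, then given the visible past its
  law at any later time is \<open>\<Lambda>\<close> of the visible state. Events of rate zero need not preserve the invariant: with
  truncated subtraction, the departure of a job of a type absent from service can end in an impossible state.
\<close>

locale intertwining =
  X: rate_chain c lx ex + Y: rate_chain c ly ey
  for c :: real and lx :: "'a::countable \<Rightarrow> nat" and ex and ly :: "'b::countable \<Rightarrow> nat" and ey +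
  fixes g :: "'a \<Rightarrow> 'b" and \<Lambda> :: "'b \<Rightarrow> 'a pmf" and Inv :: "'b \<Rightarrow> bool"
  assumes inv_step: "Inv y \<Longrightarrow> e \<in> set (ey y) \<Longrightarrow> fst e \<noteq> 0 \<Longrightarrow> z \<in> set_pmf (snd e) \<Longrightarrow> Inv z"
    and fibre: "Inv y \<Longrightarrow> x \<in> set_pmf (\<Lambda> y) \<Longrightarrow> g x = y"
    and aligned: "Inv y \<Longrightarrow> \<exists>(js :: nat list) r D D'.
      (\<forall>x\<in>set_pmf (\<Lambda> y). ex x = map (\<lambda>j. (r j, D x j)) js) \<and> ey y = map (\<lambda>j. (r j, D' j)) js \<and>
      (\<forall>j\<in>set js. bind_pmf (\<Lambda> y) (\<lambda>x. D x j) = bind_pmf (D' j) \<Lambda>)"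
begin

lemma bind_mix:
  assumes "\<forall>j\<in>set js. bind_pmf (\<Lambda> y) (\<lambda>x. D x j) = bind_pmf (D' j) \<Lambda>"
  shows "bind_pmf (\<Lambda> y) (\<lambda>x. mix (map (\<lambda>j. (r j, D x j)) js) s x) = bind_pmf (mix (map (\<lambda>j. (r j, D' j)) js) s y) \<Lambda>"
  using assms
proof (induction js arbitrary: s)
  case (Cons j js)
  have "bind_pmf (\<Lambda> y) (\<lambda>x. mix (map (\<lambda>j. (r j, D x j)) (j # js)) s x) =
    bind_pmf (bernoulli_pmf (r j / s)) (\<lambda>b. bind_pmf (\<Lambda> y)
      (\<lambda>x. if b then D x j else mix (map (\<lambda>j. (r j, D x j)) js) (s - r j) x))"
    by (simp add: bind_commute_pmf[of "\<Lambda> y"] cong: if_cong)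
  also have "\<dots> = bind_pmf (bernoulli_pmf (r j / s)) (\<lambda>b.
      bind_pmf (if b then D' j else mix (map (\<lambda>j. (r j, D' j)) js) (s - r j) y) \<Lambda>)"
    using Cons by (intro bind_pmf_cong refl) auto
  finally show ?case by (simp add: bind_assoc_pmf cong: if_cong)
qed (simp add: bind_return_pmf bind_return_pmf')

lemma bind_kern:
  assumes "Inv y"
  shows "bind_pmf (\<Lambda> y) (X.kern i) = bind_pmf (Y.kern i y) \<Lambda>"
proof -
  obtain js :: "nat list" and r D D' where al: "\<forall>x\<in>set_pmf (\<Lambda> y). ex x = map (\<lambda>j. (r j, D x j)) js"
      "ey y = map (\<lambda>j. (r j, D' j)) js" "\<forall>j\<in>set js. bind_pmf (\<Lambda> y) (\<lambda>x. D x j) = bind_pmf (D' j) \<Lambda>"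
    using aligned[OF assms] by blast
  have "bind_pmf (\<Lambda> y) (X.kern i) = bind_pmf (\<Lambda> y) (\<lambda>x. mix (map (\<lambda>j. (r j, D x j)) js) (c * real (Suc i)) x)"
    using al(1) by (intro bind_pmf_cong refl) (simp add: X.kern_def)
  also have "\<dots> = bind_pmf (Y.kern i y) \<Lambda>"
    unfolding bind_mix[OF al(3)] Y.kern_def al(2) ..
  finally show ?thesis .
qed

lemma inv_kern: "Inv x \<Longrightarrow> z \<in> set_pmf (Y.kern i x) \<Longrightarrow> Inv z"
  using set_mix[of "ey x" "c * real (Suc i)" x] inv_step[of x _ z] unfolding Y.kern_def by auto

lemma inv_steps: "Inv x \<Longrightarrow> z \<in> set_pmf (Y.steps m i x) \<Longrightarrow> Inv z"
  by (induction m arbitrary: i x) (auto dest: inv_kern)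

lemma bind_steps:
  assumes "Inv y"
  shows "bind_pmf (\<Lambda> y) (X.steps m i) = bind_pmf (Y.steps m i y) \<Lambda>"
  using assms
proof (induction m arbitrary: i y)
  case (Suc m)
  have "X.steps (Suc m) i = (\<lambda>x. bind_pmf (X.kern i x) (X.steps m (Suc i)))"
    by (rule ext) simp
  then have "bind_pmf (\<Lambda> y) (X.steps (Suc m) i) = bind_pmf (bind_pmf (\<Lambda> y) (X.kern i)) (X.steps m (Suc i))"
    by (simp add: bind_assoc_pmf)
  also have "\<dots> = bind_pmf (Y.kern i y) (\<lambda>y'. bind_pmf (\<Lambda> y') (X.steps m (Suc i)))"
    unfolding bind_kern[OF Suc.prems] by (simp add: bind_assoc_pmf)
  also have "\<dots> = bind_pmf (Y.kern i y) (\<lambda>y'. bind_pmf (Y.steps m (Suc i) y') \<Lambda>)"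
    using Suc inv_kern by (intro bind_pmf_cong refl) blast
  finally show ?case by (simp only: Y.steps.simps bind_assoc_pmf)
next
  case 0
  have "X.steps 0 i = return_pmf" by (rule ext) simp
  then show ?case by (simp add: bind_return_pmf bind_return_pmf')
qed

lemma bind_pair_kernel:
  assumes "Inv y"
  shows "bind_pmf (\<Lambda> y) (\<lambda>x. X.pair_kernel t (i, x)) =
    bind_pmf (Y.pair_kernel t (i, y)) (\<lambda>z. map_pmf (Pair (fst z)) (\<Lambda> (snd z)))"
proof -
  have "bind_pmf (\<Lambda> y) (\<lambda>x. X.pair_kernel t (i, x)) =
    bind_pmf (neg_binomial_pmf (Suc i) (exp (- (c * t)))) (\<lambda>m. map_pmf (Pair (i + m)) (bind_pmf (\<Lambda> y) (X.steps m i)))"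
    unfolding X.pair_kernel_def by (simp add: bind_commute_pmf[of "\<Lambda> y"] map_bind_pmf)
  then show ?thesis
    unfolding bind_steps[OF assms] Y.pair_kernel_def by (simp add: bind_assoc_pmf map_bind_pmf bind_map_pmf)
qed

lemma bind_path_law:
  assumes "Inv y"
  shows "bind_pmf (\<Lambda> y) (\<lambda>x. map_pmf (map (apsnd g)) (path_law X.pair_kernel (i, x) ds)) = path_law Y.pair_kernel (i, y) ds"
  using assms
proof (induction ds arbitrary: i y)
  case (Cons d ds)
  let ?k = "\<lambda>z. map_pmf ((#) (apsnd g z)) (map_pmf (map (apsnd g)) (path_law X.pair_kernel z ds))"
  have "bind_pmf (\<Lambda> y) (\<lambda>x. map_pmf (map (apsnd g)) (path_law X.pair_kernel (i, x) (d # ds))) =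
    bind_pmf (bind_pmf (\<Lambda> y) (\<lambda>x. X.pair_kernel d (i, x))) ?k"
    by (simp add: map_bind_pmf map_pmf_comp bind_assoc_pmf)
  also have "\<dots> = bind_pmf (Y.pair_kernel d (i, y)) (\<lambda>z. bind_pmf (\<Lambda> (snd z)) (\<lambda>x. ?k (fst z, x)))"
    unfolding bind_pair_kernel[OF Cons.prems] by (simp add: bind_assoc_pmf bind_map_pmf)
  also have "\<dots> = bind_pmf (Y.pair_kernel d (i, y)) (\<lambda>z. map_pmf ((#) z) (path_law Y.pair_kernel z ds))"
  proof (intro bind_pmf_cong refl)
    fix z assume z: "z \<in> set_pmf (Y.pair_kernel d (i, y))"
    obtain j y' where jy: "z = (j, y')" by fastforce
    have inv: "Inv y'" using z jy Cons.prems by (auto simp: Y.pair_kernel_def dest: inv_steps)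
    have "bind_pmf (\<Lambda> (snd z)) (\<lambda>x. ?k (fst z, x)) =
      bind_pmf (\<Lambda> y') (\<lambda>x. map_pmf ((#) z) (map_pmf (map (apsnd g)) (path_law X.pair_kernel (j, x) ds)))"
      using fibre[OF inv] jy by (intro bind_pmf_cong) auto
    also have "\<dots> = map_pmf ((#) z) (path_law Y.pair_kernel z ds)"
      unfolding jy Cons.IH[OF inv, of j, symmetric] by (simp add: map_bind_pmf)
    finally show "bind_pmf (\<Lambda> (snd z)) (\<lambda>x. ?k (fst z, x)) = map_pmf ((#) z) (path_law Y.pair_kernel z ds)" .
  qed
  finally show ?case by simp
qed simp

end

section \<open>Deletions in lists and sums over positions\<close>

lemma flow_append: "flow (xs @ ys) f x = flow xs f x + flow ys f x"
  by (induction xs) (auto simp: flow_Cons)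

lemma flow_map_upt:
  "flow (map F [i..<j]) f x = (\<Sum>k=i..<j. fst (F k) * (measure_pmf.expectation (snd (F k)) f - f x))"
  by (simp add: flow_def case_prod_unfold interv_sum_list_conv_sum_set_nat comp_def)

definition delete_nth :: "nat \<Rightarrow> 'a list \<Rightarrow> 'a list" where
  "delete_nth k xs = take k xs @ drop (Suc k) xs"

lemma length_delete_nth [simp]: "k < length xs \<Longrightarrow> length (delete_nth k xs) = length xs - 1"
  by (simp add: delete_nth_def)

lemma map_delete_nth: "map f (delete_nth k xs) = delete_nth k (map f xs)"
  by (simp add: delete_nth_def take_map drop_map)

lemma delete_nth_Suc [simp]: "delete_nth (Suc k) (x # xs) = x # delete_nth k xs"
  and delete_nth_0 [simp]: "delete_nth 0 (x # xs) = xs"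
  by (simp_all add: delete_nth_def)

lemma delete_nth_append:
  "delete_nth k (xs @ ys) = (if k < length xs then delete_nth k xs @ ys else xs @ delete_nth (k - length xs) ys)"
  by (auto simp: delete_nth_def Suc_diff_le)

lemma filter_delete_nth:
  assumes "k < length J"
  shows "filter P (delete_nth k J) =
    (if P (J ! k) then delete_nth (length (filter P (take k J))) (filter P J) else filter P J)"
proof -
  have J: "J = take k J @ J ! k # drop (Suc k) J" using id_take_nth_drop[OF assms] .
  have "filter P J = filter P (take k J) @ filter P (J ! k # drop (Suc k) J)"
    by (subst J) (simp only: filter_append)
  then show ?thesis by (simp add: delete_nth_append) (simp add: delete_nth_def)
qed

lemma filter_update_False:
  assumes "k < length J" "snd (J ! k)"
  shows "filter snd (J[k := (a, False)]) = delete_nth (length (filter snd (take k J))) (filter snd J)"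
proof -
  have J: "J = take k J @ J ! k # drop (Suc k) J" using id_take_nth_drop[OF assms(1)] .
  have "filter snd J = filter snd (take k J) @ J ! k # filter snd (drop (Suc k) J)"
    by (subst J) (use assms(2) in \<open>simp only: filter_append filter.simps if_True\<close>)
  then show ?thesis using assms(1) by (simp add: upd_conv_take_nth_drop delete_nth_append)
qed

lemma nth_filter_take:
  assumes "k < length J" "P (J ! k)"
  shows "length (filter P (take k J)) < length (filter P J)"
    and "filter P J ! length (filter P (take k J)) = J ! k"
proof -
  have J: "J = take k J @ J ! k # drop (Suc k) J" using id_take_nth_drop[OF assms(1)] .
  have "filter P J = filter P (take k J) @ J ! k # filter P (drop (Suc k) J)"
    by (subst J) (use assms(2) in \<open>simp only: filter_append filter.simps if_True\<close>)
  then show "length (filter P (take k J)) < length (filter P J)"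
    "filter P J ! length (filter P (take k J)) = J ! k"
    by simp_all
qed

text \<open>
  The number of earlier elements with property \<open>P\<close> enumerates the positions of the filtered list.
\<close>

lemma sum_over_filter:
  fixes F :: "nat \<Rightarrow> real"
  shows "(\<Sum>k<length J. if P (J ! k) then F (length (filter P (take k J))) else 0) = (\<Sum>k<length (filter P J). F k)"
proof (induction J rule: rev_induct)
  case (snoc x J)
  have "(\<Sum>k<length J. if P ((J @ [x]) ! k) then F (length (filter P (take k (J @ [x])))) else 0) =
    (\<Sum>k<length J. if P (J ! k) then F (length (filter P (take k J))) else 0)"
    by (intro sum.cong) (auto simp: nth_append)
  then show ?case using snoc by simp
qed simp

lemma sum_nth_bool:
  fixes F :: "bool \<Rightarrow> real"
  shows "(\<Sum>k<length xs. F (xs ! k)) = real (count_list xs True) * F True + real (count_list xs False) * F False"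
proof (induction xs)
  case (Cons x xs)
  then show ?case by (cases x) (simp_all add: sum.lessThan_Suc_shift algebra_simps del: sum.lessThan_Suc)
qed simp

lemma count_list_bool: "count_list xs True + count_list xs False = length xs"
  by (induction xs) auto

section \<open>Both queues, with and without the types of the waiting jobs\<close>

locale hyper_queue =
  fixes lam p mu1 mu2 theta :: real and n :: nat
  assumes pos: "0 < lam" "0 < p" "p < 1" "0 < mu1" "0 < mu2" "0 < theta"
    and impatience: "theta < min mu1 mu2"
begin

definition bound :: real where "bound = lam + mu1 + mu2 + theta"

definition coin :: "bool pmf" where "coin = bernoulli_pmf p"

lemma expectation_coin: "measure_pmf.expectation coin (f :: bool \<Rightarrow> real) = p * f True + (1 - p) * f False"
  using pos by (simp add: coin_def)

lemma finite_coin [simp]: "finite (set_pmf coin)"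
  by (rule finite_subset[of _ UNIV]) auto

definition mu :: "bool \<Rightarrow> real" where "mu b = (if b then mu1 else mu2)"

fun enter :: "bool \<Rightarrow> nat \<times> nat \<Rightarrow> nat \<times> nat" where
  "enter b (x, y) = (if b then (Suc x, y) else (x, Suc y))"

fun leave :: "bool \<Rightarrow> nat \<times> nat \<Rightarrow> nat \<times> nat" where
  "leave b (x, y) = (if b then (x - 1, y) else (x, y - 1))"

text \<open>
  The state after a server has become free: the head of the queue enters service. If nobody
  waits, the flag \<open>topup\<close> tells whether a new job is created, as in the larger system, or the server
  idles, as in the smaller one. It has this meaning throughout.
\<close>

definition promote :: "bool \<Rightarrow> nat \<times> nat \<Rightarrow> bool list \<Rightarrow> ((nat \<times> nat) \<times> bool list) pmf" where
  "promote topup s ws = (case ws of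
      [] \<Rightarrow> if topup then map_pmf (\<lambda>v. (enter v s, [])) coin else return_pmf (s, [])
    | v # vs \<Rightarrow> return_pmf (enter v s, vs))"

text \<open>
  The queue in which the type of a job is drawn on arrival; the state shows the types
  of the waiting jobs.
\<close>

definition typed_events :: "bool \<Rightarrow> (nat \<times> nat) \<times> bool list \<Rightarrow> (real \<times> ((nat \<times> nat) \<times> bool list) pmf) list" where
  "typed_events topup x = (case x of (s, ws) \<Rightarrow>
     [(lam, map_pmf (\<lambda>v. if fst s + snd s < n then (enter v s, ws) else (s, ws @ [v])) coin),
      (mu1 * real (fst s), promote topup (leave True s) ws),
      (mu2 * real (snd s), promote topup (leave False s) ws)] @
     map (\<lambda>k. (theta, return_pmf (s, delete_nth k ws))) [0..<length ws])"

definition typed_level :: "(nat \<times> nat) \<times> bool list \<Rightarrow> nat" where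
  "typed_level x = fst (fst x) + snd (fst x) + length (snd x)"

definition triple :: "nat \<times> nat \<Rightarrow> nat \<Rightarrow> state" where
  "triple s w = (fst s, snd s, w)"

text \<open>
  The queue in which the type of a job is drawn when it enters service. The list follows the events of
  the previous chain one by one, with one abandonment event per waiting job.
\<close>

definition queue_events :: "bool \<Rightarrow> state \<Rightarrow> (real \<times> state pmf) list" where
  "queue_events topup x = (case x of (a, b, w) \<Rightarrow>
     [(lam, if topup \<or> a + b = n then return_pmf (a, b, Suc w)
            else if a + b < n then map_pmf (\<lambda>v. triple (enter v (a, b)) w) coin else return_pmf (a, b, w)),
      (mu1 * real a, if w \<noteq> 0 \<or> topup then map_pmf (\<lambda>v. triple (enter v (leave True (a, b))) (w - 1)) coin
            else return_pmf (triple (leave True (a, b)) 0)),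
      (mu2 * real b, if w \<noteq> 0 \<or> topup then map_pmf (\<lambda>v. triple (enter v (leave False (a, b))) (w - 1)) coin
            else return_pmf (triple (leave False (a, b)) 0))] @
     map (\<lambda>k. (theta, return_pmf (a, b, w - 1))) [0..<w])"

definition queue_level :: "state \<Rightarrow> nat" where
  "queue_level x = (case x of (a, b, w) \<Rightarrow> a + b + w)"

lemma total_bound: "lam + (mu1 * real a + (mu2 * real b + theta * real w)) \<le> bound * real (Suc (a + b + w))"
proof -
  have "mu1 * real a \<le> bound * real a" "mu2 * real b \<le> bound * real b" "theta * real w \<le> bound * real w" "lam \<le> bound"
    using pos by (auto simp: bound_def intro!: mult_right_mono)
  then show ?thesis by (simp add: algebra_simps)
qed

sublocale typed: rate_chain bound typed_level "typed_events topup" for topup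
proof
  show "0 < bound" using pos by (simp add: bound_def)
  fix e :: "real \<times> ((nat \<times> nat) \<times> bool list) pmf" and x z :: "(nat \<times> nat) \<times> bool list"
  obtain a b ws where x: "x = ((a, b), ws)" by (metis prod.collapse)
  show "sum_list (map fst (typed_events topup x)) \<le> bound * real (Suc (typed_level x))"
    using total_bound[of a b "length ws"]
    by (simp add: x typed_events_def typed_level_def comp_def sum_list_triv mult.commute)
  assume e: "e \<in> set (typed_events topup x)"
  then show "0 \<le> fst e" using pos by (auto simp: x typed_events_def)
  show "finite (set_pmf (snd e))" using e by (auto simp: x typed_events_def promote_def split: list.splits)
  assume "z \<in> set_pmf (snd e)"
  then show "typed_level z \<le> Suc (typed_level x)"
    using e by (auto simp: x typed_events_def typed_level_def promote_def split: list.splits if_splits)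
qed

sublocale queue: rate_chain bound queue_level "queue_events topup" for topup
proof
  show "0 < bound" using pos by (simp add: bound_def)
  fix e :: "real \<times> state pmf" and x z :: state
  obtain a b w where x: "x = (a, b, w)" by (metis prod.collapse)
  show "sum_list (map fst (queue_events topup x)) \<le> bound * real (Suc (queue_level x))"
    using total_bound[of a b w]
    by (simp add: x queue_events_def queue_level_def comp_def sum_list_triv mult.commute)
  assume e: "e \<in> set (queue_events topup x)"
  then show "0 \<le> fst e" using pos by (auto simp: x queue_events_def)
  show "finite (set_pmf (snd e))" using e by (auto simp: x queue_events_def)
  assume "z \<in> set_pmf (snd e)"
  then show "queue_level z \<le> Suc (queue_level x)"
    using e by (auto simp: x queue_events_def queue_level_def triple_def split: if_splits)
qed

definition queue_inv :: "bool \<Rightarrow> state \<Rightarrow> bool" where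
  "queue_inv topup x = (case x of (a, b, w) \<Rightarrow> a + b \<le> n \<and> (w \<noteq> 0 \<or> topup \<longrightarrow> a + b = n))"

definition hidden_types :: "state \<Rightarrow> ((nat \<times> nat) \<times> bool list) pmf" where
  "hidden_types x = (case x of (a, b, w) \<Rightarrow> map_pmf (Pair (a, b)) (replicate_pmf w coin))"

definition forget_types :: "(nat \<times> nat) \<times> bool list \<Rightarrow> state" where
  "forget_types x = triple (fst x) (length (snd x))"

text \<open>
  Deleting a position chosen without looking at the entries leaves independent coin flips.
\<close>

lemma map_delete_nth_replicate_pmf:
  "k \<le> w \<Longrightarrow> map_pmf (delete_nth k) (replicate_pmf (Suc w) coin) = replicate_pmf w coin"
proof (induction w arbitrary: k)
  case 0
  then show ?case by (simp add: map_bind_pmf map_pmf_def[symmetric] bind_return_pmf map_pmf_comp)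
next
  case (Suc w)
  show ?case
  proof (cases k)
    case 0
    then show ?thesis
      by (subst replicate_pmf.simps(2)) (simp add: map_bind_pmf bind_return_pmf' bind_pmf_const del: replicate_pmf.simps)
  next
    case (Suc j)
    have "map_pmf (delete_nth k) (replicate_pmf (Suc (Suc w)) coin) =
      bind_pmf coin (\<lambda>x. map_pmf ((#) x) (map_pmf (delete_nth j) (replicate_pmf (Suc w) coin)))"
      using Suc by (subst replicate_pmf.simps(2)) (simp add: map_bind_pmf map_pmf_comp map_pmf_def[symmetric] del: replicate_pmf.simps)
    then show ?thesis using Suc.IH[of j] Suc.prems Suc by (simp add: map_pmf_def)
  qed
qed

lemma replicate_pmf_snoc:
  "bind_pmf (replicate_pmf w coin) (\<lambda>ws. map_pmf (\<lambda>v. ws @ [v]) coin) = replicate_pmf (Suc w) coin"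
  using replicate_pmf_distrib[of w 1 coin] by (simp add: map_pmf_def bind_assoc_pmf bind_return_pmf)

text \<open>
  The type of the job that enters service is revealed as a fresh coin flip, and the rest of the queue
  stays hidden.
\<close>

lemma bind_promote:
  "bind_pmf (replicate_pmf w coin) (promote topup s) =
    (if w \<noteq> 0 \<or> topup then bind_pmf coin (\<lambda>v. map_pmf (Pair (enter v s)) (replicate_pmf (w - 1) coin))
     else return_pmf (s, []))"
  by (cases w) (auto simp: promote_def bind_return_pmf bind_assoc_pmf map_pmf_def)

lemma hidden_types_triple: "hidden_types (triple s w) = map_pmf (Pair s) (replicate_pmf w coin)"
  by (simp add: hidden_types_def triple_def)

sublocale types: intertwining bound typed_level "typed_events topup" queue_level "queue_events topup"
  forget_types hidden_types "queue_inv topup" for topup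
proof
  fix y e z assume inv: "queue_inv topup y" and "e \<in> set (queue_events topup y)" "fst e \<noteq> 0" "z \<in> set_pmf (snd e)"
  then show "queue_inv topup z"
    by (cases y) (auto simp: queue_inv_def queue_events_def triple_def split: if_splits)
next
  fix y x assume "queue_inv topup y" "x \<in> set_pmf (hidden_types y)"
  then show "forget_types x = y"
    by (cases y) (auto simp: hidden_types_def forget_types_def triple_def set_replicate_pmf)
next
  fix y assume inv: "queue_inv topup y"
  obtain a b w where y: "y = (a, b, w)" by (metis prod.collapse)
  let ?rep = "replicate_pmf w coin"
  (* Event 0 is the arrival, events 1 and 2 are the completions of the two types, and event 3 + k is the
     abandonment at position k. *)
  define r where "r j = (if j = 0 then lam else if j = 1 then mu1 * real a else if j = 2 then mu2 * real b else theta)" for j :: nat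
  define D where "D x j = snd (typed_events topup x ! j)" for x j
  define D' where "D' j = snd (queue_events topup y ! j)" for j
  define js :: "nat list" where "js = [0, 1, 2] @ map ((+) 3) [0..<w]"
  have 1: "typed_events topup ((a, b), ws) = map (\<lambda>j. (r j, D ((a, b), ws) j)) js" if "length ws = w" for ws
    unfolding js_def using that by (simp add: typed_events_def r_def D_def)
  have 2: "queue_events topup y = map (\<lambda>j. (r j, D' j)) js"
    unfolding js_def by (simp add: y queue_events_def r_def D'_def)
  have 3: "bind_pmf (hidden_types y) (\<lambda>x. D x j) = bind_pmf (D' j) hidden_types" if j: "j \<in> set js" for j
  proof -
    have lhs: "bind_pmf (hidden_types y) (\<lambda>x. D x j) = bind_pmf ?rep (\<lambda>ws. D ((a, b), ws) j)"
      by (simp add: y hidden_types_def bind_map_pmf)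
    have "j < w + 3" using j unfolding js_def by auto
    then have "j = 0 \<or> j = 1 \<or> j = 2 \<or> (\<exists>k<w. j = 3 + k)" by presburger
    then consider "j = 0" | "j = 1" | "j = 2" | "\<exists>k<w. j = 3 + k" by blast
    then show ?thesis
    proof cases
      case 1
      show ?thesis
      proof (cases "a + b < n")
        case True
        then have "w = 0" "\<not> topup" "a + b \<noteq> n" using inv by (auto simp: queue_inv_def y)
        then show ?thesis using True unfolding lhs unfolding 1
          by (simp add: D_def D'_def typed_events_def y queue_events_def bind_return_pmf bind_map_pmf hidden_types_triple)
             (simp add: map_pmf_def bind_return_pmf)
      next
        case False
        then have "a + b = n" using inv by (auto simp: queue_inv_def y)
        then have "bind_pmf ?rep (\<lambda>ws. D ((a, b), ws) j) = map_pmf (Pair (a, b)) (bind_pmf ?rep (\<lambda>ws. map_pmf (\<lambda>v. ws @ [v]) coin))"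
          unfolding 1 by (simp add: D_def typed_events_def map_bind_pmf map_pmf_comp)
        then show ?thesis unfolding lhs replicate_pmf_snoc using \<open>a + b = n\<close> 1
          by (simp add: D'_def y queue_events_def bind_return_pmf hidden_types_def del: replicate_pmf.simps)
      qed
    next
      case 2
      show ?thesis unfolding lhs unfolding 2
        by (simp add: D_def D'_def typed_events_def y queue_events_def bind_promote bind_map_pmf hidden_types_triple bind_return_pmf)
    next
      case 3
      show ?thesis unfolding lhs unfolding 3
        by (simp add: D_def D'_def typed_events_def y queue_events_def bind_promote bind_map_pmf hidden_types_triple bind_return_pmf)
    next
      case ex: 4
      then obtain k where 4: "j = 3 + k" "k < w" by blast
      have "bind_pmf ?rep (\<lambda>ws. D ((a, b), ws) j) = bind_pmf ?rep (\<lambda>ws. return_pmf ((a, b), delete_nth k ws))"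
        using 4 by (intro bind_pmf_cong refl) (auto simp: D_def typed_events_def set_replicate_pmf numeral_3_eq_3)
      also have "\<dots> = map_pmf (Pair (a, b)) (map_pmf (delete_nth k) (replicate_pmf (Suc (w - 1)) coin))"
        using 4 by (simp add: map_pmf_def bind_assoc_pmf bind_return_pmf del: replicate_pmf.simps)
      also have "\<dots> = map_pmf (Pair (a, b)) (replicate_pmf (w - 1) coin)"
        using 4 by (subst map_delete_nth_replicate_pmf) auto
      also have "\<dots> = bind_pmf (D' j) hidden_types"
        using 4 by (simp add: D'_def y queue_events_def numeral_3_eq_3 bind_return_pmf hidden_types_def)
      finally show ?thesis unfolding lhs .
    qed
  qed
  show "\<exists>(js :: nat list) r D D'.
      (\<forall>x\<in>set_pmf (hidden_types y). typed_events topup x = map (\<lambda>j. (r j, D x j)) js) \<and>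
      queue_events topup y = map (\<lambda>j. (r j, D' j)) js \<and>
      (\<forall>j\<in>set js. bind_pmf (hidden_types y) (\<lambda>x. D x j) = bind_pmf (D' j) hidden_types)"
    using 1 2 3 by (intro exI[of _ js] exI[of _ r] exI[of _ D] exI[of _ D'])
      (auto simp: y hidden_types_def set_replicate_pmf)
qed

lemma pmf_map_coin: "pmf (map_pmf f coin) y = p * of_bool (f True = y) + (1 - p) * of_bool (f False = y)"
  by (simp add: map_pmf_def pmf_bind expectation_coin pmf_return)

end

section \<open>Agreement with the prescribed rates\<close>

text \<open>
  The case distinctions of the rate functions are exclusive, which turns them into sums that can be
  compared with sums over events.
\<close>

lemma Q_rate_sum:
  assumes "(a, b, w) \<noteq> (a', b', w')"
  shows "Q_rate lam p mu1 mu2 theta n (a, b, w) (a', b', w') =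
    of_bool (a' = Suc a \<and> b' = b \<and> w' = w) * (of_bool (a + b < n) * (lam * p)) +
    of_bool (a' = a \<and> b' = Suc b \<and> w' = w) * (of_bool (a + b < n) * (lam * (1 - p))) +
    of_bool (a' = a \<and> b' = b \<and> w' = Suc w) * (of_bool (a + b = n) * lam) +
    of_bool (Suc a' = a \<and> b' = b \<and> w' = w) * (of_bool (w = 0) * (mu1 * real a)) +
    of_bool (a' = a \<and> Suc b' = b \<and> w' = w) * (of_bool (w = 0) * (mu2 * real b)) +
    of_bool (Suc a' = a \<and> b' = Suc b \<and> Suc w' = w) * (of_bool (w \<ge> 1) * (mu1 * real a * (1 - p))) +
    of_bool (a' = Suc a \<and> Suc b' = b \<and> Suc w' = w) * (of_bool (w \<ge> 1) * (mu2 * real b * p)) +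
    of_bool (a' = a \<and> b' = b \<and> Suc w' = w) * (of_bool (w \<ge> 1) * (mu1 * real a * p + mu2 * real b * (1 - p) + theta * real w))"
proof -
  have excl: "(if A then x else y) = of_bool A * x + y" if "A \<Longrightarrow> y = 0" for A and x y :: real
    using that by simp
  show ?thesis
    unfolding Q_rate.simps Suc_eq_plus1
    by (subst excl, (clarsimp; fail))+ simp
qed

lemma Qbar_rate_sum:
  assumes "(a, b, w) \<noteq> (a', b', w')"
  shows "Qbar_rate lam p mu1 mu2 theta (a, b, w) (a', b', w') =
    of_bool (a' = a \<and> b' = b \<and> w' = Suc w) * lam +
    of_bool (Suc a' = a \<and> b' = Suc b \<and> w' = w) * (of_bool (w = 0) * (mu1 * real a * (1 - p))) +
    of_bool (a' = Suc a \<and> Suc b' = b \<and> w' = w) * (of_bool (w = 0) * (mu2 * real b * p)) +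
    of_bool (Suc a' = a \<and> b' = Suc b \<and> Suc w' = w) * (of_bool (w \<ge> 1) * (mu1 * real a * (1 - p))) +
    of_bool (a' = Suc a \<and> Suc b' = b \<and> Suc w' = w) * (of_bool (w \<ge> 1) * (mu2 * real b * p)) +
    of_bool (a' = a \<and> b' = b \<and> Suc w' = w) * (of_bool (w \<ge> 1) * (mu1 * real a * p + mu2 * real b * (1 - p) + theta * real w))"
proof -
  have excl: "(if A then x else y) = of_bool A * x + y" if "A \<Longrightarrow> y = 0" for A and x y :: real
    using that by simp
  show ?thesis
    unfolding Qbar_rate.simps Suc_eq_plus1
    by (subst excl, (clarsimp; fail))+ simp
qed

context hyper_queue
begin

lemma sum_queue_events:
  "(\<Sum>(r, D)\<leftarrow>queue_events topup (a, b, w). r * pmf D y) =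
     lam * pmf (if topup \<or> a + b = n then return_pmf (a, b, Suc w)
            else if a + b < n then map_pmf (\<lambda>v. triple (enter v (a, b)) w) coin else return_pmf (a, b, w)) y +
     mu1 * real a * pmf (if w \<noteq> 0 \<or> topup then map_pmf (\<lambda>v. triple (enter v (leave True (a, b))) (w - 1)) coin
            else return_pmf (triple (leave True (a, b)) 0)) y +
     mu2 * real b * pmf (if w \<noteq> 0 \<or> topup then map_pmf (\<lambda>v. triple (enter v (leave False (a, b))) (w - 1)) coin
            else return_pmf (triple (leave False (a, b)) 0)) y +
     theta * real w * of_bool ((a, b, w - 1) = y)"
  by (simp add: queue_events_def comp_def case_prod_unfold sum_list_triv pmf_return)

lemma mass_arrival:
  assumes "(a, b, w) \<noteq> (a', b', w')"
  shows "pmf (if topup \<or> a + b = n then return_pmf (a, b, Suc w)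
            else if a + b < n then map_pmf (\<lambda>v. triple (enter v (a, b)) w) coin else return_pmf (a, b, w)) (a', b', w') =
    (if topup \<or> a + b = n then of_bool (a' = a \<and> b' = b \<and> w' = Suc w)
     else of_bool (a + b < n) * (p * of_bool (a' = Suc a \<and> b' = b \<and> w' = w) + (1 - p) * of_bool (a' = a \<and> b' = Suc b \<and> w' = w)))"
proof -
  have "pmf (return_pmf (a, b, Suc w)) (a', b', w') = of_bool (a' = a \<and> b' = b \<and> w' = Suc w)"
    by (auto simp: pmf_return)
  moreover have "pmf (return_pmf (a, b, w)) (a', b', w') = 0"
    using assms by (auto simp: pmf_return)
  moreover have "pmf (map_pmf (\<lambda>v. triple (enter v (a, b)) w) coin) (a', b', w') =
    p * of_bool (a' = Suc a \<and> b' = b \<and> w' = w) + (1 - p) * of_bool (a' = a \<and> b' = Suc b \<and> w' = w)"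
    unfolding pmf_map_coin triple_def by (simp add: eq_commute[of a'] eq_commute[of b'] eq_commute[of w'])
  ultimately show ?thesis
    by (cases "topup \<or> a + b = n"; cases "a + b < n") simp_all
qed

text \<open>
  The factor \<open>real a\<close> matters here: for \<open>a = 0\<close> the truncated predecessor of \<open>a\<close> makes the masses
  different.
\<close>

lemma mass_completion_True:
  "real a * pmf (map_pmf (\<lambda>v. triple (enter v (leave True (a, b))) w) coin) (a', b', w') =
     real a * (p * of_bool (a' = a \<and> b' = b \<and> w' = w) + (1 - p) * of_bool (Suc a' = a \<and> b' = Suc b \<and> w' = w))"
proof (cases a)
  case (Suc k)
  have "triple (enter True (leave True (a, b))) w = (a', b', w') \<longleftrightarrow> a' = a \<and> b' = b \<and> w' = w"
    and "triple (enter False (leave True (a, b))) w = (a', b', w') \<longleftrightarrow> Suc a' = a \<and> b' = Suc b \<and> w' = w"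
    using Suc by (auto simp: triple_def)
  then show ?thesis unfolding pmf_map_coin by (simp only:)
qed simp

lemma mass_completion_False:
  "real b * pmf (map_pmf (\<lambda>v. triple (enter v (leave False (a, b))) w) coin) (a', b', w') =
     real b * (p * of_bool (a' = Suc a \<and> Suc b' = b \<and> w' = w) + (1 - p) * of_bool (a' = a \<and> b' = b \<and> w' = w))"
proof (cases b)
  case (Suc k)
  have "triple (enter True (leave False (a, b))) w = (a', b', w') \<longleftrightarrow> a' = Suc a \<and> Suc b' = b \<and> w' = w"
    and "triple (enter False (leave False (a, b))) w = (a', b', w') \<longleftrightarrow> a' = a \<and> b' = b \<and> w' = w"
    using Suc by (auto simp: triple_def)
  then show ?thesis unfolding pmf_map_coin by (simp only:)
qed simp

lemma mass_departure:
  "real a * pmf (return_pmf (triple (leave True (a, b)) w)) (a', b', w') = real a * of_bool (Suc a' = a \<and> b' = b \<and> w' = w)"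
  "real b * pmf (return_pmf (triple (leave False (a, b)) w)) (a', b', w') = real b * of_bool (a' = a \<and> Suc b' = b \<and> w' = w)"
  by (cases a, auto simp: pmf_return triple_def) (cases b, auto simp: pmf_return triple_def)

lemma sum_queue_events_bool:
  assumes "(a, b, w) \<noteq> (a', b', w')"
  shows "(\<Sum>(r, D)\<leftarrow>queue_events topup (a, b, w). r * pmf D (a', b', w')) =
    lam * (if topup \<or> a + b = n then of_bool (a' = a \<and> b' = b \<and> w' = Suc w)
     else of_bool (a + b < n) * (p * of_bool (a' = Suc a \<and> b' = b \<and> w' = w) + (1 - p) * of_bool (a' = a \<and> b' = Suc b \<and> w' = w))) +
    mu1 * (real a * (if w \<noteq> 0 \<or> topup then p * of_bool (a' = a \<and> b' = b \<and> w' = w - 1) + (1 - p) * of_bool (Suc a' = a \<and> b' = Suc b \<and> w' = w - 1)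
       else of_bool (Suc a' = a \<and> b' = b \<and> w' = 0))) +
    mu2 * (real b * (if w \<noteq> 0 \<or> topup then p * of_bool (a' = Suc a \<and> Suc b' = b \<and> w' = w - 1) + (1 - p) * of_bool (a' = a \<and> b' = b \<and> w' = w - 1)
       else of_bool (a' = a \<and> Suc b' = b \<and> w' = 0))) +
    theta * real w * of_bool (a' = a \<and> b' = b \<and> w' = w - 1)"
proof -
  have "of_bool ((a, b, w - 1) = (a', b', w')) = (of_bool (a' = a \<and> b' = b \<and> w' = w - 1) :: real)" by auto
  then show ?thesis
    unfolding sum_queue_events mass_arrival[OF assms]
    by (simp only: if_distrib[of "\<lambda>D. pmf D (a', b', w')"] mult.assoc[of mu1] mult.assoc[of mu2]
          if_distrib[of "(*) (real a)"] if_distrib[of "(*) (real b)"] mass_completion_True mass_completion_False mass_departure)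
qed

lemma Q_rate_eq:
  assumes "x \<noteq> y"
  shows "Q_rate lam p mu1 mu2 theta n x y = (\<Sum>(r, D)\<leftarrow>queue_events False x. r * pmf D y)"
proof -
  obtain a b w where x: "x = (a, b, w)" by (metis prod.collapse)
  obtain a' b' w' where y: "y = (a', b', w')" by (metis prod.collapse)
  note ne = assms[unfolded x y]
  show ?thesis
    unfolding x y sum_queue_events_bool[OF ne] Q_rate_sum[OF ne]
    by (cases w) (simp_all add: algebra_simps)
qed

lemma Qbar_rate_eq:
  assumes "x \<noteq> y"
  shows "Qbar_rate lam p mu1 mu2 theta x y = (\<Sum>(r, D)\<leftarrow>queue_events True x. r * pmf D y)"
proof -
  obtain a b w where x: "x = (a, b, w)" by (metis prod.collapse)
  obtain a' b' w' where y: "y = (a', b', w')" by (metis prod.collapse)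
  note ne = assms[unfolded x y]
  have same: "\<not> (a' = a \<and> b' = b \<and> w' = w)" using ne by auto
  show ?thesis
    unfolding x y sum_queue_events_bool[OF ne] Qbar_rate_sum[OF ne]
    by (cases w) (use same in \<open>auto simp: algebra_simps\<close>)
qed

end

section \<open>The list of jobs that couples both queues\<close>

lemma sum_lessThan_add:
  fixes F :: "nat \<Rightarrow> real"
  shows "(\<Sum>k<m + l. F k) = (\<Sum>k<m. F k) + (\<Sum>k<l. F (m + k))"
  by (induction l) auto

definition counts :: "bool list \<Rightarrow> nat \<times> nat" where
  "counts xs = (count_list xs True, count_list xs False)"

context hyper_queue
begin

lemma counts_snoc: "counts (xs @ [v]) = enter v (counts xs)"
  by (simp add: counts_def)

lemma counts_delete_nth: "k < length xs \<Longrightarrow> counts (delete_nth k xs) = leave (xs ! k) (counts xs)"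
proof -
  assume k: "k < length xs"
  have "counts xs = counts (take k xs @ xs ! k # drop (Suc k) xs)"
    using id_take_nth_drop[OF k] by simp
  then show ?thesis by (simp add: counts_def delete_nth_def)
qed

lemma counts_sum: "fst (counts xs) + snd (counts xs) = length xs"
  by (simp add: counts_def count_list_bool)

definition summary :: "bool list \<Rightarrow> (nat \<times> nat) \<times> bool list" where
  "summary zs = (counts (take n zs), drop n zs)"

text \<open>
  The rate at which the job at position \<open>k\<close> leaves a system.
\<close>

definition speed :: "nat \<Rightarrow> bool \<Rightarrow> real" where
  "speed k b = (if k < n then mu b else theta)"

definition refill :: "bool \<Rightarrow> (bool \<Rightarrow> 'a) \<Rightarrow> 'a list \<Rightarrow> 'a list pmf" where
  "refill topup mk xs = (if topup \<and> length xs < n then map_pmf (\<lambda>v. xs @ [mk v]) coin else return_pmf xs)"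

text \<open>
  The generator of one system run on its own as a list of types in order of arrival, applied to
  a function of \<open>summary\<close>. Both systems obey this dynamics, and it depends only on \<open>summary\<close>.
\<close>

definition list_flow :: "bool \<Rightarrow> ((nat \<times> nat) \<times> bool list \<Rightarrow> real) \<Rightarrow> bool list \<Rightarrow> real" where
  "list_flow topup f zs =
     lam * (measure_pmf.expectation coin (\<lambda>v. f (summary (zs @ [v]))) - f (summary zs)) +
     (\<Sum>k<length zs. speed k (zs ! k) *
        (measure_pmf.expectation (refill topup id (delete_nth k zs)) (\<lambda>z. f (summary z)) - f (summary zs)))"

text \<open>
  When a job in service is deleted, the first waiting job moves into the first \<open>n\<close> positions; deletion
  from the list thus includes the start of the next service.
\<close>

lemma map_summary_refill:
  assumes "k < n" "k < length zs"
  shows "map_pmf summary (refill topup id (delete_nth k zs)) = promote topup (leave (zs ! k) (counts (take n zs))) (drop n zs)"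
proof (cases "drop n zs")
  case Nil
  then have le: "length zs \<le> n" by simp
  then have len: "length (delete_nth k zs) < n" using assms by simp
  have "summary (delete_nth k zs) = (leave (zs ! k) (counts zs), [])"
    using len assms by (simp add: summary_def counts_delete_nth)
  moreover have "summary (delete_nth k zs @ [v]) = (enter v (leave (zs ! k) (counts zs)), [])" for v
    using len assms by (simp add: summary_def counts_snoc counts_delete_nth)
  ultimately show ?thesis
    using le len by (simp add: refill_def promote_def map_pmf_comp)
next
  case (Cons v vs)
  let ?t = "take n zs"
  have gt: "n < length zs"
  proof (rule ccontr)
    assume "\<not> n < length zs"
    then show False using Cons by simp
  qed
  have zs: "?t @ v # vs = zs" using append_take_drop_id[of n zs] Cons by simp
  have "delete_nth k (?t @ v # vs) = delete_nth k ?t @ v # vs"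
    using assms by (simp add: delete_nth_append)
  then have del: "delete_nth k zs = (delete_nth k ?t @ [v]) @ vs" unfolding zs by simp
  have len: "length (delete_nth k ?t @ [v]) = n" using assms gt by simp
  have split: "summary (xs @ vs) = (counts xs, vs)" if "length xs = n" for xs
    using that by (simp add: summary_def)
  have "summary (delete_nth k zs) = (counts (delete_nth k ?t @ [v]), vs)"
    unfolding del by (rule split[OF len])
  also have "\<dots> = (enter v (leave (zs ! k) (counts ?t)), vs)"
    using assms by (simp add: counts_snoc counts_delete_nth)
  finally have "summary (delete_nth k zs) = (enter v (leave (zs ! k) (counts ?t)), vs)" .
  moreover have "\<not> length (delete_nth k zs) < n" using gt assms by simp
  ultimately show ?thesis
    using Cons by (simp add: refill_def promote_def del: length_delete_nth)
qed

lemma list_flow_eq: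
  assumes "topup \<Longrightarrow> n \<le> length zs"
  shows "list_flow topup f zs = flow (typed_events topup (summary zs)) f (summary zs)"
proof -
  define s where "s = counts (take n zs)"
  define ws where "ws = drop n zs"
  define m where "m = length (take n zs)"
  have sum: "summary zs = (s, ws)" by (simp add: summary_def s_def ws_def)
  have len: "length zs = m + length ws" by (simp add: m_def ws_def)
  have ssum: "fst s + snd s = m" by (simp add: s_def m_def counts_sum)
  define H where "H b = mu b * (measure_pmf.expectation (promote topup (leave b s) ws) f - f (s, ws))" for b
  (* Positions below m are in service, the others wait; with m < n there are no others. *)
  have arrival: "summary (zs @ [v]) = (if fst s + snd s < n then (enter v s, ws) else (s, ws @ [v]))" for v
    unfolding ssum by (auto simp: m_def s_def ws_def summary_def counts_snoc)
  have serve: "speed k (zs ! k) * (measure_pmf.expectation (refill topup id (delete_nth k zs)) (\<lambda>z. f (summary z)) - f (summary zs))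
     = H (take n zs ! k)" if "k < m" for k
  proof -
    have k: "k < n" "k < length zs" using that by (auto simp: m_def)
    have "measure_pmf.expectation (refill topup id (delete_nth k zs)) (\<lambda>z. f (summary z)) =
      measure_pmf.expectation (promote topup (leave (zs ! k) s) ws) f"
      using map_summary_refill[OF k, of topup] by (simp add: s_def ws_def flip: integral_map_pmf)
    then show ?thesis using k by (simp add: H_def speed_def sum)
  qed
  have abandon: "speed (m + k) (zs ! (m + k)) * (measure_pmf.expectation (refill topup id (delete_nth (m + k) zs)) (\<lambda>z. f (summary z)) - f (summary zs))
     = theta * (f (s, delete_nth k ws) - f (s, ws))" if "k < length ws" for k
  proof -
    have m: "m = n" "n + k < length zs" using that by (auto simp: m_def ws_def)
    have "delete_nth (n + k) zs = delete_nth (n + k) (take n zs @ ws)" by (simp add: ws_def)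
    also have "\<dots> = take n zs @ delete_nth k ws" using m by (simp add: delete_nth_append)
    finally have "summary (delete_nth (n + k) zs) = (s, delete_nth k ws)"
      using m by (simp add: summary_def s_def)
    moreover have "\<not> length (delete_nth (n + k) zs) < n" using m by simp
    ultimately show ?thesis using m by (simp add: refill_def speed_def sum)
  qed
  have "list_flow topup f zs = lam * (measure_pmf.expectation coin (\<lambda>v. f (summary (zs @ [v]))) - f (summary zs)) +
    ((\<Sum>k<m. H (take n zs ! k)) + (\<Sum>k<length ws. theta * (f (s, delete_nth k ws) - f (s, ws))))"
    unfolding list_flow_def len sum_lessThan_add by (simp add: serve abandon)
  also have "(\<Sum>k<m. H (take n zs ! k)) = real (fst s) * H True + real (snd s) * H False"
    unfolding m_def sum_nth_bool by (simp add: s_def counts_def)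
  finally show ?thesis
    unfolding sum typed_events_def arrival
    by (simp add: flow_Cons flow_append flow_map_upt H_def mu_def atLeast0LessThan integral_map_pmf algebra_simps cong: if_cong)
qed

text \<open>
  The position of job \<open>k\<close> in the smaller system, provided that it is flagged.
\<close>

definition rank :: "nat \<Rightarrow> (bool \<times> bool) list \<Rightarrow> nat" where
  "rank k J = length (filter snd (take k J))"

lemma rank_le: "rank k J \<le> k"
  unfolding rank_def by (rule order_trans[OF length_filter_le]) simp

text \<open>
  The first components of jobs are types and the second ones tell whether the job is still in the smaller
  system. A flagged job leaves the larger system at rate \<open>speed k\<close>, and then both; it leaves the
  smaller system at rate \<open>speed (rank k J)\<close> in total.
\<close>

definition job_events :: "(bool \<times> bool) list \<Rightarrow> (real \<times> (bool \<times> bool) list pmf) list" where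
  "job_events J =
     (lam, map_pmf (\<lambda>v. J @ [(v, True)]) coin) #
     map (\<lambda>k. (speed k (fst (J ! k)), refill True (\<lambda>v. (v, False)) (delete_nth k J))) [0..<length J] @
     map (\<lambda>k. (if snd (J ! k) then speed (rank k J) (fst (J ! k)) - speed k (fst (J ! k)) else 0,
       return_pmf (J[k := (fst (J ! k), False)]))) [0..<length J]"

text \<open>
  A job that waits in the larger system and is served in the smaller one abandons the former no faster
  than it leaves the latter; this makes the rates at which flags are lost nonnegative.
\<close>

lemma speed_antimono: "j \<le> k \<Longrightarrow> speed k b \<le> speed j b"
  using impatience by (auto simp: speed_def mu_def)

lemma speed_bounds: "0 \<le> speed k b" "speed k b \<le> bound"
  using pos by (auto simp: speed_def mu_def bound_def)

sublocale jobs: rate_chain bound length job_events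
proof
  show "0 < bound" using pos by (simp add: bound_def)
  fix e :: "real \<times> (bool \<times> bool) list pmf" and J z :: "(bool \<times> bool) list"
  have "sum_list (map fst (job_events J)) = lam + (\<Sum>k<length J. speed k (fst (J ! k)) +
    (if snd (J ! k) then speed (rank k J) (fst (J ! k)) - speed k (fst (J ! k)) else 0))"
    by (simp add: job_events_def comp_def interv_sum_list_conv_sum_set_nat atLeast0LessThan sum.distrib)
  also have "(\<Sum>k<length J. speed k (fst (J ! k)) +
    (if snd (J ! k) then speed (rank k J) (fst (J ! k)) - speed k (fst (J ! k)) else 0)) \<le> of_nat (card {..<length J}) * bound"
    using speed_bounds by (intro sum_bounded_above) auto
  also have "lam + of_nat (card {..<length J}) * bound \<le> bound * real (Suc (length J))"
    using pos by (simp add: algebra_simps bound_def)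
  finally show "sum_list (map fst (job_events J)) \<le> bound * real (Suc (length J))" by simp
  assume e: "e \<in> set (job_events J)"
  then show "0 \<le> fst e"
    using pos speed_bounds speed_antimono[OF rank_le] by (auto simp: job_events_def)
  show "finite (set_pmf (snd e))" using e by (auto simp: job_events_def refill_def)
  assume "z \<in> set_pmf (snd e)"
  then show "length z \<le> Suc (length J)"
    using e by (auto simp: job_events_def refill_def split: if_splits)
qed

definition types_present :: "bool \<Rightarrow> (bool \<times> bool) list \<Rightarrow> bool list" where
  "types_present topup J = map fst (if topup then J else filter snd J)"

text \<open>
  Each system follows its own dynamics. In the larger one, losing the flag is invisible. In the
  smaller one, only the events of flagged jobs are visible, and the two events of such a job have
  the same effect, so their rates add up to the rate at its rank.
\<close>

lemma flow_jobs:
  "flow (job_events J) (\<lambda>J. f (summary (types_present topup J))) J = list_flow topup f (types_present topup J)"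
proof -
  let ?h = "\<lambda>J. f (summary (types_present topup J))"
  define dep where "dep k = measure_pmf.expectation (refill True (\<lambda>v. (v, False)) (delete_nth k J)) ?h - ?h J" for k
  define unfl where "unfl k = (if snd (J ! k) then speed (rank k J) (fst (J ! k)) - speed k (fst (J ! k)) else 0) *
     (?h (J[k := (fst (J ! k), False)]) - ?h J)" for k
  let ?zs = "types_present topup J"
  define G where "G k = measure_pmf.expectation (refill topup id (delete_nth k ?zs)) (\<lambda>z. f (summary z)) - f (summary ?zs)" for k
  have "flow (job_events J) ?h J = lam * (measure_pmf.expectation coin (\<lambda>v. ?h (J @ [(v, True)])) - ?h J) +
     (\<Sum>k<length J. speed k (fst (J ! k)) * dep k + unfl k)"
    by (simp add: job_events_def flow_Cons flow_append flow_map_upt dep_def unfl_def atLeast0LessThan sum.distrib)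
  also have "(\<lambda>v. ?h (J @ [(v, True)])) = (\<lambda>v. f (summary (?zs @ [v])))"
    by (simp add: types_present_def)
  also have "(\<Sum>k<length J. speed k (fst (J ! k)) * dep k + unfl k) = (\<Sum>k<length ?zs. speed k (?zs ! k) * G k)"
  proof (cases topup)
    case True
    have "speed k (fst (J ! k)) * dep k + unfl k = speed k (?zs ! k) * G k" if "k < length J" for k
    proof -
      have "map fst (J[k := (fst (J ! k), False)]) = map fst J"
        using that by (simp add: map_update) (metis list_update_id nth_map)
      then have "unfl k = 0" using True by (simp add: unfl_def types_present_def)
      moreover have fresh: "map_pmf (map fst) (refill True (\<lambda>v. (v, False)) (delete_nth k J)) = refill topup id (delete_nth k ?zs)"
        using True that by (simp add: refill_def types_present_def map_pmf_comp map_delete_nth)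
      then have "dep k = G k"
        using True unfolding dep_def G_def fresh[symmetric] integral_map_pmf by (simp add: types_present_def)
      ultimately show ?thesis using True that by (simp add: types_present_def)
    qed
    then show ?thesis using True by (simp add: types_present_def)
  next
    case False
    define E where "E k = speed k (?zs ! k) * G k" for k
    have "speed k (fst (J ! k)) * dep k + unfl k = (if snd (J ! k) then E (rank k J) else 0)" if k: "k < length J" for k
    proof -
      have unseen: "map_pmf (types_present topup) (refill True (\<lambda>v. (v, False)) (delete_nth k J)) =
        return_pmf (types_present topup (delete_nth k J))"
        using False by (simp add: refill_def map_pmf_comp types_present_def)
      have "dep k = measure_pmf.expectation (map_pmf (types_present topup) (refill True (\<lambda>v. (v, False)) (delete_nth k J)))
          (\<lambda>z. f (summary z)) - f (summary ?zs)"
        unfolding dep_def by (simp only: integral_map_pmf)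
      then have dep: "dep k = f (summary (types_present topup (delete_nth k J))) - f (summary ?zs)"
        unfolding unseen by simp
      show ?thesis
      proof (cases "snd (J ! k)")
        case flag: True
        have "types_present topup (delete_nth k J) = delete_nth (rank k J) ?zs"
          using False flag k by (simp add: types_present_def filter_delete_nth rank_def map_delete_nth)
        moreover have "types_present topup (J[k := (fst (J ! k), False)]) = delete_nth (rank k J) ?zs"
          using False flag k by (simp add: types_present_def filter_update_False rank_def map_delete_nth)
        moreover have "?zs ! rank k J = fst (J ! k)"
          using False nth_filter_take[of k J snd] flag k by (simp add: types_present_def rank_def)
        ultimately show ?thesis using flag False
          by (simp add: dep unfl_def E_def G_def refill_def algebra_simps)
      next
        case unflag: False
        then have "types_present topup (delete_nth k J) = ?zs"
          using False k by (simp add: types_present_def filter_delete_nth)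
        then show ?thesis using unflag by (simp add: dep unfl_def)
      qed
    qed
    then have "(\<Sum>k<length J. speed k (fst (J ! k)) * dep k + unfl k) = (\<Sum>k<length J. if snd (J ! k) then E (rank k J) else 0)"
      by (intro sum.cong) auto
    also have "\<dots> = (\<Sum>k<length (filter snd J). E k)"
      unfolding rank_def by (rule sum_over_filter)
    finally show ?thesis using False by (simp add: E_def types_present_def)
  qed
  finally show ?thesis by (simp add: list_flow_def G_def)
qed

lemma typed_level_summary: "typed_level (summary zs) = length zs"
  using counts_sum[of "take n zs"] by (simp add: typed_level_def summary_def)

sublocale jobs_types: strong_lumping bound length job_events typed_level "typed_events topup"
  "\<lambda>J. summary (types_present topup J)" "\<lambda>J. n \<le> length J" for topup
proof
  fix J z :: "(bool \<times> bool) list" and e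
  assume J: "n \<le> length J"
  show "typed_level (summary (types_present topup J)) \<le> length J"
    unfolding typed_level_summary by (simp add: types_present_def)
  show "flow (job_events J) (\<lambda>J. indicator {y} (summary (types_present topup J))) J =
    flow (typed_events topup (summary (types_present topup J))) (indicator {y}) (summary (types_present topup J))" for y
    unfolding flow_jobs[where f = "indicator {y}"] using J by (intro list_flow_eq) (simp add: types_present_def)
  assume "e \<in> set (job_events J)" "z \<in> set_pmf (snd e)"
  then show "n \<le> length z" using J by (auto simp: job_events_def refill_def split: if_splits)
qed

definition observe :: "bool \<Rightarrow> (bool \<times> bool) list \<Rightarrow> state" where
  "observe topup J = forget_types (summary (types_present topup J))"

lemma waiting_observe: "waiting (observe topup J) = length (types_present topup J) - n"
  by (simp add: observe_def forget_types_def waiting_def triple_def summary_def)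

definition start :: "nat \<Rightarrow> nat \<Rightarrow> (bool \<times> bool) list" where
  "start n1 n2 = replicate n1 (True, True) @ replicate n2 (False, True)"

definition coupled :: "nat \<Rightarrow> nat \<Rightarrow> bool \<Rightarrow> real \<Rightarrow> outcome \<Rightarrow> state" where
  "coupled n1 n2 topup t \<omega> = observe topup (snd (jobs.process (n, start n1 n2) t \<omega>))"

lemma summary_start:
  assumes "n1 + n2 = n"
  shows "summary (types_present topup (start n1 n2)) = ((n1, n2), [])"
proof -
  have "types_present topup (start n1 n2) = replicate n1 True @ replicate n2 False"
    by (simp add: types_present_def start_def)
  moreover have "count_list (replicate k b) v = (if b = v then k else 0)" for k and b v :: bool
    by (induction k) auto
  ultimately show ?thesis using assms by (simp add: summary_def counts_def)
qed

lemma distr_coupled: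
  assumes "n1 + n2 = n" and ds: "\<forall>d\<in>set ds. 0 \<le> d"
  shows "distr clocks (count_space UNIV) (\<lambda>\<omega>. map (\<lambda>s. coupled n1 n2 topup s \<omega>) (partial_sums 0 ds)) =
    measure_pmf (path_law (queue.transition topup) (n1, n2, 0) ds)"
proof -
  let ?z = "(n, start n1 n2)" and ?y = "(n1, n2, 0) :: state"
  let ?\<phi> = "\<lambda>J. summary (types_present topup J)"
  have len: "length (start n1 n2) = n" using assms by (simp add: start_def)
  have inv: "queue_inv topup ?y" using assms by (simp add: queue_inv_def)
  have "\<forall>s\<in>set (partial_sums 0 ds). 0 \<le> s" using partial_sums_ge[OF ds] by blast
  note meas = jobs.measurable_process_list[OF this, of ?z]
  have "distr clocks (count_space UNIV) (\<lambda>\<omega>. map (\<lambda>s. coupled n1 n2 topup s \<omega>) (partial_sums 0 ds)) =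
    distr (distr clocks (count_space UNIV) (\<lambda>\<omega>. map (\<lambda>s. jobs.process ?z s \<omega>) (partial_sums 0 ds)))
      (count_space UNIV) (map (\<lambda>z. observe topup (snd z)))"
    by (subst distr_distr[OF _ meas]) (auto simp: comp_def coupled_def)
  also have "\<dots> = measure_pmf (map_pmf (map (\<lambda>z. observe topup (snd z))) (path_law jobs.pair_kernel ?z ds))"
    unfolding jobs.distr_process[OF ds] by (simp add: map_pmf_rep_eq)
  also have "map_pmf (map (\<lambda>z. observe topup (snd z))) (path_law jobs.pair_kernel ?z ds) =
    map_pmf (map snd) (map_pmf (map (apsnd forget_types)) (map_pmf (map (apsnd ?\<phi>)) (path_law jobs.pair_kernel ?z ds)))"
    by (simp add: map_pmf_comp comp_def observe_def)
  also have "map_pmf (map (apsnd ?\<phi>)) (path_law jobs.pair_kernel ?z ds) = path_law (typed.pair_kernel topup) (n, ((n1, n2), [])) ds"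
    using jobs_types.map_path_law[of "start n1 n2" n topup ds] len by (simp add: summary_start[OF assms(1)])
  also have "map_pmf (map (apsnd forget_types)) (path_law (typed.pair_kernel topup) (n, ((n1, n2), [])) ds) =
    path_law (queue.pair_kernel topup) (n, ?y) ds"
    using types.bind_path_law[OF inv, of n ds] by (simp add: hidden_types_def bind_return_pmf)
  also have "map_pmf (map snd) (path_law (queue.pair_kernel topup) (n, ?y) ds) = path_law (queue.transition topup) ?y ds"
    using assms by (intro queue.path_law_transition) (auto simp: queue_level_def)
  finally show ?thesis .
qed

lemma is_ctmc_coupled:
  assumes "n1 + n2 = n"
    and q: "\<And>x y. x \<noteq> y \<Longrightarrow> q x y = (\<Sum>(r, D)\<leftarrow>queue_events topup x. r * pmf D y)"
  shows "is_ctmc clocks (coupled n1 n2 topup) q"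
proof (rule queue.is_ctmcI[OF q])
  show "coupled n1 n2 topup t \<in> measurable clocks (count_space UNIV)" if "0 \<le> t" for t
    unfolding coupled_def using jobs.measurable_process[OF that]
    by (rule measurable_compose) simp
  show "\<forall>\<^sub>F s in at_right t. coupled n1 n2 topup s \<omega> = coupled n1 n2 topup t \<omega>" if "0 \<le> t" for t \<omega>
    using jobs.process_right_continuous[OF that, of "(n, start n1 n2)" \<omega>]
    by eventually_elim (simp add: coupled_def)
  show "distr clocks (count_space UNIV) (\<lambda>\<omega>. map (\<lambda>s. coupled n1 n2 topup s \<omega>) (partial_sums 0 ds)) =
    measure_pmf (path_law (queue.transition topup) (n1, n2, 0) ds)" if "\<forall>d\<in>set ds. 0 \<le> d" for ds
    using distr_coupled[OF assms(1) that] .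
qed

lemma coupled_0: "n1 + n2 = n \<Longrightarrow> coupled n1 n2 topup 0 \<omega> = (n1, n2, 0)"
  by (simp add: coupled_def jobs.process_0 observe_def summary_start forget_types_def triple_def)

lemma waiting_coupled: "waiting (coupled n1 n2 False t \<omega>) \<le> waiting (coupled n1 n2 True t \<omega>)"
  unfolding coupled_def waiting_observe by (intro diff_le_mono) (simp add: types_present_def)

end

theorem theorem2:
  fixes lam p mu1 mu2 theta :: real and n n1 n2 w :: nat
  assumes "lam > 0" and "0 < p" and "p < 1"
    and "mu1 > 0" and "mu2 > 0" and "theta > 0"
    and "p / mu1 + (1 - p) / mu2 = 1"
    and "n \<ge> 1"
    and "theta < min mu1 mu2"
    and "n1 + n2 = n" and "w = 0"
  shows "\<exists>(M :: outcome measure) (Q :: real \<Rightarrow> outcome \<Rightarrow> state) (Qbar :: real \<Rightarrow> outcome \<Rightarrow> state).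
           prob_space M \<and>
           is_ctmc M Q (Q_rate lam p mu1 mu2 theta n) \<and>
           is_ctmc M Qbar (Qbar_rate lam p mu1 mu2 theta) \<and>
           (\<forall>\<omega>\<in>space M. Q 0 \<omega> = (n1, n2, w) \<and> Qbar 0 \<omega> = (n1, n2, w)) \<and>
           (AE \<omega> in M. \<forall>t\<ge>0. waiting (Qbar t \<omega>) \<ge> waiting (Q t \<omega>))"
proof -
  interpret hyper_queue lam p mu1 mu2 theta n
    using assms by unfold_locales auto
  have "prob_space clocks" by (rule clocks.prob_space_axioms)
  moreover have "is_ctmc clocks (coupled n1 n2 False) (Q_rate lam p mu1 mu2 theta n)"
    using assms(10) by (rule is_ctmc_coupled) (rule Q_rate_eq)
  moreover have "is_ctmc clocks (coupled n1 n2 True) (Qbar_rate lam p mu1 mu2 theta)"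
    using assms(10) by (rule is_ctmc_coupled) (rule Qbar_rate_eq)
  ultimately show ?thesis
    using assms(10,11) coupled_0 waiting_coupled
    by (intro exI[of _ clocks] exI[of _ "coupled n1 n2 False"] exI[of _ "coupled n1 n2 True"]) simp
qed

end
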